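(* Let $(H,R_H)$ and $(I,R_I)$ be Rota-Baxter groups such that the center $\mathrm{Z}(I)$ is a Rota-Baxter subgroup of $(I,R_I)$ (i.e. $R_I(\mathrm{Z}(I))\subseteq \mathrm{Z}(I)$), and let $\alpha:H\to\mathrm{Out}(I)$ be a coupling. Then there exists a free action of the group $\mathrm{H}^2_{RBE}(H,\mathrm{Z}(I))$ on the set $\mathcal{H}^2_\alpha(H,I)$, where $(\mathrm{Z}(I),R_I)$ is regarded as an $(H,R_H)$-module with respect to the action induced by the elements of $\mathcal{Z}^2_\alpha(H,I)$.
   Context: A Rota-Baxter operator (of weight 1) on a group $G$ is a map $R_G:G\to G$ with $R_G(x)R_G(y)=R_G(xR_G(x)yR_G(x)^{-1})$ for all $x,y$; $(G,R_G)$ is then a Rota-Baxter group. Morphisms are group homomorphisms commuting with the operators. Write $x\circ_{R_G}y=xR_G(x)yR_G(x)^{-1}$. A Rota-Baxter extension of $(H,R_H)$ by $(I,R_I)$ is a Rota-Baxter group $(E,R_E)$ with a short exact sequence of groups $I\to E\to H$ whose maps are morphisms of Rota-Baxter groups. Two extensions are equivalent if there is a Rota-Baxter isomorphism between the middle groups inducing the identity on $I$ and on $H$. Associated triplets: for $x\in I$, $i_x(y)=xyx^{-1}$. An associated triplet $(\mu,\tau,g)$ consists of maps $\mu:H\to\mathrm{Aut}(I)$, $\tau:H\times H\to I$, $g:H\to I$ with $\tau(1,h)=\tau(h,1)=1$, $g(1)=1$, such that for all $h_1,h_2,h_3\in H$, $y_1,y_2\in I$: (T1) $\mu_{h_1h_2}=i_{\tau(h_1,h_2)}\mu_{h_2}\mu_{h_1}$;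 (T2) $\tau(h_1,h_2h_3)\tau(h_2,h_3)=\tau(h_1h_2,h_3)\mu_{h_3}(\tau(h_1,h_2))$; (T3) with $r_k=R_H(h_k)$, $\rho_k=R_I\big(g(h_k)^{-1}\mu_{r_k}(y_k)g(h_k)\big)$ ($k=1,2$), $m=h_1\circ_{R_H}h_2$ and $$w=\tau(h_1r_1,h_2r_1^{-1})\,\mu_{h_2r_1^{-1}}\big(\tau(h_1,r_1)\mu_{r_1}(y_1)g(h_1)\rho_1\big)\,\tau(h_2,r_1^{-1})\,\mu_{r_1^{-1}}\big(y_2\rho_1^{-1}g(h_1)^{-1}\big)\,\tau(r_1,r_1^{-1})^{-1},$$ one has $g(m)\,R_I\big(g(m)^{-1}\mu_{r_1r_2}(w)g(m)\big)=\tau(r_1,r_2)\,\mu_{r_2}(g(h_1)\rho_1)\,g(h_2)\rho_2$. Such a triplet defines the Rota-Baxter extension $\mathcal{E}(\mu,\tau,g)$ on $H\times I$ with product $(h_1,y_1)(h_2,y_2)=(h_1h_2,\tau(h_1,h_2)\mu_{h_2}(y_1)y_2)$, operator $R(h,y)=\big(R_H(h),g(h)R_I(g(h)^{-1}\mu_{R_H(h)}(y)g(h))\big)$, and natural injection and projection. $\mathrm{Out}(I)=\mathrm{Aut}(I)/\mathrm{Inn}(I)$; $\bar\mu$ is the composite of $\mu$ with $\mathrm{Aut}(I)\to\mathrm{Out}(I)$; by (T1) it is an anti-homomorphism. A coupling is an anti-homomorphism $\alpha:H\to\mathrm{Out}(I)$. $\mathcal{Z}^2_\alpha(H,I)$ is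 the set of associated triplets with $\bar\mu=\alpha$; two triplets are related by $\sim$ if the extensions they define are equivalent; $\mathcal{H}^2_\alpha(H,I)=\mathcal{Z}^2_\alpha(H,I)/\!\sim$. All elements of $\mathcal{Z}^2_\alpha(H,I)$ induce by restriction the same action $\tilde\mu_h=\mu_h|_{\mathrm{Z}(I)}$ on $\mathrm{Z}(I)$, namely that determined by $\alpha$. Cohomology of $A=\mathrm{Z}(I)$ (additive notation, with action $\tilde\mu$ and endomorphism $R_I|_A$): $C^n(H,A)$ is the group of functions $H^n\to A$ vanishing whenever some argument is $1$. For $\theta\in C^1$: $(\delta^1\theta)(h_1,h_2)=\theta(h_2)-\theta(h_1h_2)+\tilde\mu_{h_2}(\theta(h_1))$, $\Phi^1(\theta)(h)=R_I(\tilde\mu_{R_H(h)}(\theta(h)))-\theta(R_H(h))$, $(\partial^1\theta)(h_1,h_2)=\theta(h_2)-\theta(h_1\circ_{R_H}h_2)+\tilde\mu_{R_H(h_2)}(\theta(h_1))$. For $f\in C^2$: $$\Phi^2(f)(h_1,h_2)=f(R_H(h_1),R_H(h_2))-R_I\Big(\tilde\mu_{R_H(h_1\circ_{R_H}h_2)}\big(f(h_1R_H(h_1),h_2R_H(h_1)^{-1})+\tilde\mu_{h_2R_H(h_1)^{-1}}(f(h_1,R_H(h_1)))+f(h_2,R_H(h_1)^{-1})-f(R_H(h_1),R_H(h_1)^{-1})\big)\Big).$$ $\mathrm{Z}^2_{RBE}(H,A)$ is the group of $(\tau,g)\in C^2\oplus C^1$ with $\tau(h_1,h_2h_3)+\tau(h_2,h_3)-\tau(h_1h_2,h_3)-\tilde\mu_{h_3}(\tau(h_1,h_2))=0$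 and $(\partial^1g)(h_1,h_2)-R_I\big(\tilde\mu_{R_H(h_2)}(\tilde\mu_{h_2}(g(h_1))-g(h_1))\big)-\Phi^2(\tau)(h_1,h_2)=0$; $\mathrm{B}^2_{RBE}(H,A)=\{(\delta^1\theta,-\Phi^1(\theta)):\theta\in C^1\}$ is a subgroup, and $\mathrm{H}^2_{RBE}(H,A)=\mathrm{Z}^2_{RBE}(H,A)/\mathrm{B}^2_{RBE}(H,A)$. *)

theory Defs
  imports "HOL-Algebra.Algebra"
begin

section \<open>Rota-Baxter groups and their extensions\<close>

definition rb_circ :: "('a, 'm) monoid_scheme \<Rightarrow> ('a \<Rightarrow> 'a) \<Rightarrow> 'a \<Rightarrow> 'a \<Rightarrow> 'a" where
  "rb_circ G R x y = x \<otimes>\<^bsub>G\<^esub> R x \<otimes>\<^bsub>G\<^esub> y \<otimes>\<^bsub>G\<^esub> inv\<^bsub>G\<^esub> (R x)"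

definition rota_baxter_group :: "('a, 'm) monoid_scheme \<Rightarrow> ('a \<Rightarrow> 'a) \<Rightarrow> bool" where
  "rota_baxter_group G R \<longleftrightarrow> group G \<and> R \<in> carrier G \<rightarrow> carrier G \<and>
     (\<forall>x\<in>carrier G. \<forall>y\<in>carrier G. R x \<otimes>\<^bsub>G\<^esub> R y = R (rb_circ G R x y))"

definition rb_hom ::
  "('a, 'm) monoid_scheme \<Rightarrow> ('a \<Rightarrow> 'a) \<Rightarrow> ('b, 'n) monoid_scheme \<Rightarrow> ('b \<Rightarrow> 'b) \<Rightarrow> ('a \<Rightarrow> 'b) set" where
  "rb_hom G R G' R' = {f \<in> hom G G'. \<forall>x\<in>carrier G. f (R x) = R' (f x)}"

definition rb_extension ::
  "('h, 'm) monoid_scheme \<Rightarrow> ('h \<Rightarrow> 'h) \<Rightarrow> ('i, 'n) monoid_scheme \<Rightarrow> ('i \<Rightarrow> 'i) \<Rightarrow>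
   ('e, 'k) monoid_scheme \<Rightarrow> ('e \<Rightarrow> 'e) \<Rightarrow> ('i \<Rightarrow> 'e) \<Rightarrow> ('e \<Rightarrow> 'h) \<Rightarrow> bool" where
  "rb_extension H RH I RI E RE \<iota> \<pi> \<longleftrightarrow>
     rota_baxter_group E RE \<and> \<iota> \<in> rb_hom I RI E RE \<and> \<pi> \<in> rb_hom E RE H RH \<and>
     inj_on \<iota> (carrier I) \<and> \<iota> ` carrier I = kernel E H \<pi> \<and> \<pi> ` carrier E = carrier H"

definition rb_extension_equiv ::
  "('h, 'm) monoid_scheme \<Rightarrow> ('h \<Rightarrow> 'h) \<Rightarrow> ('i, 'n) monoid_scheme \<Rightarrow> ('i \<Rightarrow> 'i) \<Rightarrow>
   ('e, 'k) monoid_scheme \<Rightarrow> ('e \<Rightarrow> 'e) \<Rightarrow> ('i \<Rightarrow> 'e) \<Rightarrow> ('e \<Rightarrow> 'h) \<Rightarrow>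
   ('f, 'l) monoid_scheme \<Rightarrow> ('f \<Rightarrow> 'f) \<Rightarrow> ('i \<Rightarrow> 'f) \<Rightarrow> ('f \<Rightarrow> 'h) \<Rightarrow> bool" where
  "rb_extension_equiv H RH I RI E RE \<iota> \<pi> E' RE' \<iota>' \<pi>' \<longleftrightarrow>
     rb_extension H RH I RI E RE \<iota> \<pi> \<and> rb_extension H RH I RI E' RE' \<iota>' \<pi>' \<and>
     (\<exists>F. F \<in> iso E E' \<and> F \<in> rb_hom E RE E' RE' \<and>
          (\<forall>y\<in>carrier I. F (\<iota> y) = \<iota>' y) \<and> (\<forall>e\<in>carrier E. \<pi>' (F e) = \<pi> e))"

section \<open>Center, inner and outer automorphisms, couplings\<close>

definition center :: "('a, 'm) monoid_scheme \<Rightarrow> 'a set" where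
  "center G = {z \<in> carrier G. \<forall>x\<in>carrier G. z \<otimes>\<^bsub>G\<^esub> x = x \<otimes>\<^bsub>G\<^esub> z}"

definition center_group :: "('a, 'm) monoid_scheme \<Rightarrow> ('a, 'm) monoid_scheme" where
  "center_group G = G\<lparr>carrier := center G\<rparr>"

definition inner_auto :: "('a, 'm) monoid_scheme \<Rightarrow> 'a \<Rightarrow> 'a \<Rightarrow> 'a" where
  "inner_auto G x = (\<lambda>y\<in>carrier G. x \<otimes>\<^bsub>G\<^esub> y \<otimes>\<^bsub>G\<^esub> inv\<^bsub>G\<^esub> x)"

definition Inn :: "('a, 'm) monoid_scheme \<Rightarrow> ('a \<Rightarrow> 'a) set" where
  "Inn G = inner_auto G ` carrier G"

definition OutGroup :: "('a, 'm) monoid_scheme \<Rightarrow> ('a \<Rightarrow> 'a) set monoid" where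
  "OutGroup G = AutoGroup G Mod Inn G"

definition coupling ::
  "('h, 'm) monoid_scheme \<Rightarrow> ('i, 'n) monoid_scheme \<Rightarrow> ('h \<Rightarrow> ('i \<Rightarrow> 'i) set) \<Rightarrow> bool" where
  "coupling H I \<alpha> \<longleftrightarrow> \<alpha> \<in> carrier H \<rightarrow> carrier (OutGroup I) \<and>
     (\<forall>h1\<in>carrier H. \<forall>h2\<in>carrier H. \<alpha> (h1 \<otimes>\<^bsub>H\<^esub> h2) = \<alpha> h2 \<otimes>\<^bsub>OutGroup I\<^esub> \<alpha> h1)"

text \<open>
  All automorphisms in the coset \<open>\<alpha> h\<close> agree on the center, since inner automorphisms fix it
  pointwise; hence the image of \<open>\<alpha> h\<close> under evaluation at a central element is a singleton.
\<close>

definition coupling_action :: "('h \<Rightarrow> ('i \<Rightarrow> 'i) set) \<Rightarrow> 'h \<Rightarrow> 'i \<Rightarrow> 'i" where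
  "coupling_action \<alpha> h z = the_elem ((\<lambda>f. f z) ` \<alpha> h)"

section \<open>Associated triplets\<close>

text \<open>
  The components of a triplet are extensional functions, so that two triplets are equal exactly
  if they agree on \<open>H\<close>, respectively \<open>H \<times> H\<close>.
\<close>

type_synonym ('h, 'i) triplet = "('h \<Rightarrow> 'i \<Rightarrow> 'i) \<times> ('h \<times> 'h \<Rightarrow> 'i) \<times> ('h \<Rightarrow> 'i)"

definition triplet_rb_condition ::
  "('h, 'm) monoid_scheme \<Rightarrow> ('h \<Rightarrow> 'h) \<Rightarrow> ('i, 'n) monoid_scheme \<Rightarrow> ('i \<Rightarrow> 'i) \<Rightarrow>
   ('h, 'i) triplet \<Rightarrow> 'h \<Rightarrow> 'h \<Rightarrow> 'i \<Rightarrow> 'i \<Rightarrow> bool" where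
  "triplet_rb_condition H RH I RI = (\<lambda>(\<mu>, \<tau>, g) h1 h2 y1 y2.
     (let r1 = RH h1; r2 = RH h2;
          \<rho>1 = RI (inv\<^bsub>I\<^esub> (g h1) \<otimes>\<^bsub>I\<^esub> \<mu> r1 y1 \<otimes>\<^bsub>I\<^esub> g h1);
          \<rho>2 = RI (inv\<^bsub>I\<^esub> (g h2) \<otimes>\<^bsub>I\<^esub> \<mu> r2 y2 \<otimes>\<^bsub>I\<^esub> g h2);
          m = rb_circ H RH h1 h2;
          s = inv\<^bsub>H\<^esub> r1;
          w = \<tau> (h1 \<otimes>\<^bsub>H\<^esub> r1, h2 \<otimes>\<^bsub>H\<^esub> s)
              \<otimes>\<^bsub>I\<^esub> \<mu> (h2 \<otimes>\<^bsub>H\<^esub> s) (\<tau> (h1, r1) \<otimes>\<^bsub>I\<^esub> \<mu> r1 y1 \<otimes>\<^bsub>I\<^esub> g h1 \<otimes>\<^bsub>I\<^esub> \<rho>1)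
              \<otimes>\<^bsub>I\<^esub> \<tau> (h2, s)
              \<otimes>\<^bsub>I\<^esub> \<mu> s (y2 \<otimes>\<^bsub>I\<^esub> inv\<^bsub>I\<^esub> \<rho>1 \<otimes>\<^bsub>I\<^esub> inv\<^bsub>I\<^esub> (g h1))
              \<otimes>\<^bsub>I\<^esub> inv\<^bsub>I\<^esub> (\<tau> (r1, s))
      in g m \<otimes>\<^bsub>I\<^esub> RI (inv\<^bsub>I\<^esub> (g m) \<otimes>\<^bsub>I\<^esub> \<mu> (r1 \<otimes>\<^bsub>H\<^esub> r2) w \<otimes>\<^bsub>I\<^esub> g m)
         = \<tau> (r1, r2) \<otimes>\<^bsub>I\<^esub> \<mu> r2 (g h1 \<otimes>\<^bsub>I\<^esub> \<rho>1) \<otimes>\<^bsub>I\<^esub> g h2 \<otimes>\<^bsub>I\<^esub> \<rho>2))"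

definition associated_triplets ::
  "('h, 'm) monoid_scheme \<Rightarrow> ('h \<Rightarrow> 'h) \<Rightarrow> ('i, 'n) monoid_scheme \<Rightarrow> ('i \<Rightarrow> 'i) \<Rightarrow>
   ('h, 'i) triplet set" where
  "associated_triplets H RH I RI = {(\<mu>, \<tau>, g).
     \<mu> \<in> carrier H \<rightarrow>\<^sub>E auto I \<and>
     \<tau> \<in> carrier H \<times> carrier H \<rightarrow>\<^sub>E carrier I \<and>
     g \<in> carrier H \<rightarrow>\<^sub>E carrier I \<and>
     (\<forall>h\<in>carrier H. \<tau> (\<one>\<^bsub>H\<^esub>, h) = \<one>\<^bsub>I\<^esub> \<and> \<tau> (h, \<one>\<^bsub>H\<^esub>) = \<one>\<^bsub>I\<^esub>) \<and>
     g \<one>\<^bsub>H\<^esub> = \<one>\<^bsub>I\<^esub> \<and>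
     (\<forall>h1\<in>carrier H. \<forall>h2\<in>carrier H. \<forall>y\<in>carrier I.
        \<mu> (h1 \<otimes>\<^bsub>H\<^esub> h2) y = inner_auto I (\<tau> (h1, h2)) (\<mu> h2 (\<mu> h1 y))) \<and>
     (\<forall>h1\<in>carrier H. \<forall>h2\<in>carrier H. \<forall>h3\<in>carrier H.
        \<tau> (h1, h2 \<otimes>\<^bsub>H\<^esub> h3) \<otimes>\<^bsub>I\<^esub> \<tau> (h2, h3)
        = \<tau> (h1 \<otimes>\<^bsub>H\<^esub> h2, h3) \<otimes>\<^bsub>I\<^esub> \<mu> h3 (\<tau> (h1, h2))) \<and>
     (\<forall>h1\<in>carrier H. \<forall>h2\<in>carrier H. \<forall>y1\<in>carrier I. \<forall>y2\<in>carrier I.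
        triplet_rb_condition H RH I RI (\<mu>, \<tau>, g) h1 h2 y1 y2)}"

definition triplet_group ::
  "('h, 'm) monoid_scheme \<Rightarrow> ('i, 'n) monoid_scheme \<Rightarrow> ('h, 'i) triplet \<Rightarrow> ('h \<times> 'i) monoid" where
  "triplet_group H I = (\<lambda>(\<mu>, \<tau>, g).
     \<lparr>carrier = carrier H \<times> carrier I,
      monoid.mult = (\<lambda>(h1, y1) (h2, y2).
        (h1 \<otimes>\<^bsub>H\<^esub> h2, \<tau> (h1, h2) \<otimes>\<^bsub>I\<^esub> \<mu> h2 y1 \<otimes>\<^bsub>I\<^esub> y2)),
      one = (\<one>\<^bsub>H\<^esub>, \<one>\<^bsub>I\<^esub>)\<rparr>)"

definition triplet_operator ::
  "('h \<Rightarrow> 'h) \<Rightarrow> ('i, 'n) monoid_scheme \<Rightarrow> ('i \<Rightarrow> 'i) \<Rightarrow> ('h, 'i) triplet \<Rightarrow>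
   'h \<times> 'i \<Rightarrow> 'h \<times> 'i" where
  "triplet_operator RH I RI = (\<lambda>(\<mu>, \<tau>, g) (h, y).
     (RH h, g h \<otimes>\<^bsub>I\<^esub> RI (inv\<^bsub>I\<^esub> (g h) \<otimes>\<^bsub>I\<^esub> \<mu> (RH h) y \<otimes>\<^bsub>I\<^esub> g h)))"

definition triplet_equiv ::
  "('h, 'm) monoid_scheme \<Rightarrow> ('h \<Rightarrow> 'h) \<Rightarrow> ('i, 'n) monoid_scheme \<Rightarrow> ('i \<Rightarrow> 'i) \<Rightarrow>
   ('h, 'i) triplet \<Rightarrow> ('h, 'i) triplet \<Rightarrow> bool" where
  "triplet_equiv H RH I RI t t' \<longleftrightarrow>
     rb_extension_equiv H RH I RI
       (triplet_group H I t) (triplet_operator RH I RI t) (\<lambda>y. (\<one>\<^bsub>H\<^esub>, y)) fst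
       (triplet_group H I t') (triplet_operator RH I RI t') (\<lambda>y. (\<one>\<^bsub>H\<^esub>, y)) fst"

definition coupled_triplets ::
  "('h, 'm) monoid_scheme \<Rightarrow> ('h \<Rightarrow> 'h) \<Rightarrow> ('i, 'n) monoid_scheme \<Rightarrow> ('i \<Rightarrow> 'i) \<Rightarrow>
   ('h \<Rightarrow> ('i \<Rightarrow> 'i) set) \<Rightarrow> ('h, 'i) triplet set" where
  "coupled_triplets H RH I RI \<alpha> =
     {(\<mu>, \<tau>, g) \<in> associated_triplets H RH I RI.
        \<forall>h\<in>carrier H. Inn I #>\<^bsub>AutoGroup I\<^esub> \<mu> h = \<alpha> h}"

definition triplet_classes ::
  "('h, 'm) monoid_scheme \<Rightarrow> ('h \<Rightarrow> 'h) \<Rightarrow> ('i, 'n) monoid_scheme \<Rightarrow> ('i \<Rightarrow> 'i) \<Rightarrow>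
   ('h \<Rightarrow> ('i \<Rightarrow> 'i) set) \<Rightarrow> ('h, 'i) triplet set set" where
  "triplet_classes H RH I RI \<alpha> =
     coupled_triplets H RH I RI \<alpha> //
       {(t, t'). t \<in> coupled_triplets H RH I RI \<alpha> \<and> t' \<in> coupled_triplets H RH I RI \<alpha> \<and>
                 triplet_equiv H RH I RI t t'}"

section \<open>Second Rota-Baxter cohomology group\<close>

text \<open>
  The coefficient group \<open>A\<close> is written multiplicatively; \<open>R\<close> is its operator and \<open>a h\<close> is the
  action of \<open>h\<close>. Cochains are extensional.
\<close>

definition C1 :: "('h, 'm) monoid_scheme \<Rightarrow> ('a, 'n) monoid_scheme \<Rightarrow> ('h \<Rightarrow> 'a) set" where
  "C1 H A = {\<theta> \<in> carrier H \<rightarrow>\<^sub>E carrier A. \<theta> \<one>\<^bsub>H\<^esub> = \<one>\<^bsub>A\<^esub>}"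

definition C2 :: "('h, 'm) monoid_scheme \<Rightarrow> ('a, 'n) monoid_scheme \<Rightarrow> ('h \<times> 'h \<Rightarrow> 'a) set" where
  "C2 H A = {f \<in> carrier H \<times> carrier H \<rightarrow>\<^sub>E carrier A.
     \<forall>h\<in>carrier H. f (\<one>\<^bsub>H\<^esub>, h) = \<one>\<^bsub>A\<^esub> \<and> f (h, \<one>\<^bsub>H\<^esub>) = \<one>\<^bsub>A\<^esub>}"

definition C1_group :: "('h, 'm) monoid_scheme \<Rightarrow> ('a, 'n) monoid_scheme \<Rightarrow> ('h \<Rightarrow> 'a) monoid" where
  "C1_group H A = (product_group (carrier H) (\<lambda>_. A))\<lparr>carrier := C1 H A\<rparr>"

definition C2_group :: "('h, 'm) monoid_scheme \<Rightarrow> ('a, 'n) monoid_scheme \<Rightarrow> ('h \<times> 'h \<Rightarrow> 'a) monoid" where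
  "C2_group H A = (product_group (carrier H \<times> carrier H) (\<lambda>_. A))\<lparr>carrier := C2 H A\<rparr>"

definition delta1 ::
  "('h, 'm) monoid_scheme \<Rightarrow> ('a, 'n) monoid_scheme \<Rightarrow> ('h \<Rightarrow> 'a \<Rightarrow> 'a) \<Rightarrow>
   ('h \<Rightarrow> 'a) \<Rightarrow> 'h \<times> 'h \<Rightarrow> 'a" where
  "delta1 H A a \<theta> = (\<lambda>(h1, h2)\<in>carrier H \<times> carrier H.
     \<theta> h2 \<otimes>\<^bsub>A\<^esub> inv\<^bsub>A\<^esub> (\<theta> (h1 \<otimes>\<^bsub>H\<^esub> h2)) \<otimes>\<^bsub>A\<^esub> a h2 (\<theta> h1))"

definition Phi1 ::
  "('h, 'm) monoid_scheme \<Rightarrow> ('h \<Rightarrow> 'h) \<Rightarrow> ('a, 'n) monoid_scheme \<Rightarrow> ('a \<Rightarrow> 'a) \<Rightarrow>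
   ('h \<Rightarrow> 'a \<Rightarrow> 'a) \<Rightarrow> ('h \<Rightarrow> 'a) \<Rightarrow> 'h \<Rightarrow> 'a" where
  "Phi1 H RH A R a \<theta> = (\<lambda>h\<in>carrier H. R (a (RH h) (\<theta> h)) \<otimes>\<^bsub>A\<^esub> inv\<^bsub>A\<^esub> (\<theta> (RH h)))"

definition partial1 ::
  "('h, 'm) monoid_scheme \<Rightarrow> ('h \<Rightarrow> 'h) \<Rightarrow> ('a, 'n) monoid_scheme \<Rightarrow>
   ('h \<Rightarrow> 'a \<Rightarrow> 'a) \<Rightarrow> ('h \<Rightarrow> 'a) \<Rightarrow> 'h \<times> 'h \<Rightarrow> 'a" where
  "partial1 H RH A a \<theta> = (\<lambda>(h1, h2)\<in>carrier H \<times> carrier H.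
     \<theta> h2 \<otimes>\<^bsub>A\<^esub> inv\<^bsub>A\<^esub> (\<theta> (rb_circ H RH h1 h2)) \<otimes>\<^bsub>A\<^esub> a (RH h2) (\<theta> h1))"

definition Phi2 ::
  "('h, 'm) monoid_scheme \<Rightarrow> ('h \<Rightarrow> 'h) \<Rightarrow> ('a, 'n) monoid_scheme \<Rightarrow> ('a \<Rightarrow> 'a) \<Rightarrow>
   ('h \<Rightarrow> 'a \<Rightarrow> 'a) \<Rightarrow> ('h \<times> 'h \<Rightarrow> 'a) \<Rightarrow> 'h \<times> 'h \<Rightarrow> 'a" where
  "Phi2 H RH A R a f = (\<lambda>(h1, h2)\<in>carrier H \<times> carrier H.
     f (RH h1, RH h2) \<otimes>\<^bsub>A\<^esub>
     inv\<^bsub>A\<^esub> (R (a (RH (rb_circ H RH h1 h2))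
       (f (h1 \<otimes>\<^bsub>H\<^esub> RH h1, h2 \<otimes>\<^bsub>H\<^esub> inv\<^bsub>H\<^esub> (RH h1))
        \<otimes>\<^bsub>A\<^esub> a (h2 \<otimes>\<^bsub>H\<^esub> inv\<^bsub>H\<^esub> (RH h1)) (f (h1, RH h1))
        \<otimes>\<^bsub>A\<^esub> f (h2, inv\<^bsub>H\<^esub> (RH h1))
        \<otimes>\<^bsub>A\<^esub> inv\<^bsub>A\<^esub> (f (RH h1, inv\<^bsub>H\<^esub> (RH h1)))))))"

definition Z2_RBE ::
  "('h, 'm) monoid_scheme \<Rightarrow> ('h \<Rightarrow> 'h) \<Rightarrow> ('a, 'n) monoid_scheme \<Rightarrow> ('a \<Rightarrow> 'a) \<Rightarrow>
   ('h \<Rightarrow> 'a \<Rightarrow> 'a) \<Rightarrow> (('h \<times> 'h \<Rightarrow> 'a) \<times> ('h \<Rightarrow> 'a)) set" where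
  "Z2_RBE H RH A R a = {(\<tau>, g) \<in> C2 H A \<times> C1 H A.
     (\<forall>h1\<in>carrier H. \<forall>h2\<in>carrier H. \<forall>h3\<in>carrier H.
        \<tau> (h1, h2 \<otimes>\<^bsub>H\<^esub> h3) \<otimes>\<^bsub>A\<^esub> \<tau> (h2, h3)
        \<otimes>\<^bsub>A\<^esub> inv\<^bsub>A\<^esub> (\<tau> (h1 \<otimes>\<^bsub>H\<^esub> h2, h3)) \<otimes>\<^bsub>A\<^esub> inv\<^bsub>A\<^esub> (a h3 (\<tau> (h1, h2))) = \<one>\<^bsub>A\<^esub>) \<and>
     (\<forall>h1\<in>carrier H. \<forall>h2\<in>carrier H.
        partial1 H RH A a g (h1, h2)
        \<otimes>\<^bsub>A\<^esub> inv\<^bsub>A\<^esub> (R (a (RH h2) (a h2 (g h1) \<otimes>\<^bsub>A\<^esub> inv\<^bsub>A\<^esub> (g h1))))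
        \<otimes>\<^bsub>A\<^esub> inv\<^bsub>A\<^esub> (Phi2 H RH A R a \<tau> (h1, h2)) = \<one>\<^bsub>A\<^esub>)}"

definition B2_RBE ::
  "('h, 'm) monoid_scheme \<Rightarrow> ('h \<Rightarrow> 'h) \<Rightarrow> ('a, 'n) monoid_scheme \<Rightarrow> ('a \<Rightarrow> 'a) \<Rightarrow>
   ('h \<Rightarrow> 'a \<Rightarrow> 'a) \<Rightarrow> (('h \<times> 'h \<Rightarrow> 'a) \<times> ('h \<Rightarrow> 'a)) set" where
  "B2_RBE H RH A R a =
     {(delta1 H A a \<theta>, \<lambda>h\<in>carrier H. inv\<^bsub>A\<^esub> (Phi1 H RH A R a \<theta> h)) | \<theta>. \<theta> \<in> C1 H A}"

text \<open>
  Coboundaries are cocycles whenever there is a triplet with coupling \<open>\<alpha>\<close>: the third triplet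
  condition then makes the center a module over \<open>(H, RH)\<close>. This is lemma
  \<open>B2_RBE_subset_Z2_RBE\<close> below.
\<close>

definition gdiff where "gdiff A x y = x \<otimes>\<^bsub>A\<^esub> inv\<^bsub>A\<^esub> y"

context comm_group begin


lemma gdiff_rules1: "x \<in> carrier G \<Longrightarrow> y \<in> carrier G \<Longrightarrow> gdiff G x y \<in> carrier G"
  by (simp add: gdiff_def)
lemma gdiff_rules2: "\<lbrakk>x \<in> carrier G; y \<in> carrier G; z \<in> carrier G; w \<in> carrier G\<rbrakk> \<Longrightarrow>
   gdiff G x y \<otimes> gdiff G z w = gdiff G (x \<otimes> z) (y \<otimes> w)"
  by (simp add: gdiff_def inv_mult m_ac)
lemma gdiff_rules3: "x \<in> carrier G \<Longrightarrow> y \<in> carrier G \<Longrightarrow> inv (gdiff G x y) = gdiff G y x"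
  by (simp add: gdiff_def inv_mult m_ac)
lemma gdiff_rules4: "\<lbrakk>x \<in> carrier G; y \<in> carrier G; z \<in> carrier G\<rbrakk> \<Longrightarrow> x \<otimes> gdiff G y z = gdiff G (x \<otimes> y) z"
  "\<lbrakk>x \<in> carrier G; y \<in> carrier G; z \<in> carrier G\<rbrakk> \<Longrightarrow> gdiff G y z \<otimes> x = gdiff G (x \<otimes> y) z"
  "\<lbrakk>x \<in> carrier G; y \<in> carrier G; z \<in> carrier G\<rbrakk> \<Longrightarrow> gdiff G x (gdiff G y z) = gdiff G (x \<otimes> z) y"
  "\<lbrakk>x \<in> carrier G; y \<in> carrier G; z \<in> carrier G\<rbrakk> \<Longrightarrow> gdiff G (gdiff G y z) x = gdiff G y (x \<otimes> z)"
  by (simp_all add: gdiff_def inv_mult m_ac)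
lemma gdiff_rules5: "\<lbrakk>x \<in> carrier G; y \<in> carrier G\<rbrakk> \<Longrightarrow> gdiff G x y = \<one> \<longleftrightarrow> x = y"
  unfolding gdiff_def by (metis inv_closed inv_equality inv_inv r_inv)
lemma gdiff_rules6: "x \<otimes> inv y = gdiff G x y"
  by (simp add: gdiff_def)
lemmas gdiff_rules = gdiff_rules1 gdiff_rules2 gdiff_rules3 gdiff_rules4 gdiff_rules5 gdiff_rules6

end

lemma hom_gdiff:
  assumes "comm_group A" "f \<in> hom A A" "x \<in> carrier A" "y \<in> carrier A"
  shows "f (gdiff A x y) = gdiff A (f x) (f y)"
proof -
  interpret comm_group A by fact
  interpret group_hom A A f by unfold_locales fact
  show ?thesis using assms by (simp add: gdiff_def)
qed

lemma rb_coboundaries_are_cocycles: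
  fixes H :: "('h, 'm) monoid_scheme" and A :: "('a, 'n) monoid_scheme"
  assumes A: "comm_group A" and rb: "rota_baxter_group H RH" 
    and R: "R \<in> hom A A" and a: "\<And>h. h \<in> carrier H \<Longrightarrow> a h \<in> hom A A"
    and am: "\<And>h k z. h \<in> carrier H \<Longrightarrow> k \<in> carrier H \<Longrightarrow> z \<in> carrier A \<Longrightarrow>
                a (h \<otimes>\<^bsub>H\<^esub> k) z = a k (a h z)"
    and a1: "\<And>z. z \<in> carrier A \<Longrightarrow> a \<one>\<^bsub>H\<^esub> z = z"
    and md: "\<And>h z. h \<in> carrier H \<Longrightarrow> z \<in> carrier A \<Longrightarrow>
       R (a (RH h) (a h (z \<otimes>\<^bsub>A\<^esub> R z) \<otimes>\<^bsub>A\<^esub> inv\<^bsub>A\<^esub> (R z))) = a (RH h) (R z)"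
  shows "B2_RBE H RH A R a \<subseteq> Z2_RBE H RH A R a"
proof -
  interpret A: comm_group A by fact
  interpret H: group H using rb by (simp add: rota_baxter_group_def)
  have RHc [simp]: "RH h \<in> carrier H" if "h \<in> carrier H" for h
    using rb that by (auto simp: rota_baxter_group_def)
  have cc [simp]: "rb_circ H RH h k \<in> carrier H" if "h \<in> carrier H" "k \<in> carrier H" for h k
    using that by (simp add: rb_circ_def)
  have RHm: "RH (rb_circ H RH h k) = RH h \<otimes>\<^bsub>H\<^esub> RH k" if "h \<in> carrier H" "k \<in> carrier H" for h k
    using rb that by (auto simp: rota_baxter_group_def)
  have RH1: "RH \<one>\<^bsub>H\<^esub> = \<one>\<^bsub>H\<^esub>"
    using RHm[of "\<one>\<^bsub>H\<^esub>" "\<one>\<^bsub>H\<^esub>"] by (simp add: rb_circ_def)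
  have Rc [simp]: "R z \<in> carrier A" if "z \<in> carrier A" for z
    using R that by (auto simp: hom_def)
  have ac [simp]: "a h z \<in> carrier A" if "h \<in> carrier H" "z \<in> carrier A" for h z
    using a[of h] that by (auto simp: hom_def)
  have Rm: "R (x \<otimes>\<^bsub>A\<^esub> y) = R x \<otimes>\<^bsub>A\<^esub> R y" if "x \<in> carrier A" "y \<in> carrier A" for x y
    using R that by (simp add: hom_def)
  have amm: "a h (x \<otimes>\<^bsub>A\<^esub> y) = a h x \<otimes>\<^bsub>A\<^esub> a h y" if "h \<in> carrier H" "x \<in> carrier A" "y \<in> carrier A" for h x y
    using a[of h] that by (simp add: hom_def)
  have Rg: "R (gdiff A x y) = gdiff A (R x) (R y)" if "x \<in> carrier A" "y \<in> carrier A" for x y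
    using hom_gdiff[OF A R] that .
  have ag: "a h (gdiff A x y) = gdiff A (a h x) (a h y)" if "h \<in> carrier H" "x \<in> carrier A" "y \<in> carrier A" for h x y
    using hom_gdiff[OF A a] that by simp
  have R1: "R \<one>\<^bsub>A\<^esub> = \<one>\<^bsub>A\<^esub>" using R A.is_group by (rule hom_one) (rule A.is_group)
  have aone: "a h \<one>\<^bsub>A\<^esub> = \<one>\<^bsub>A\<^esub>" if "h \<in> carrier H" for h 
    using a[OF that] A.is_group by (rule hom_one) (rule A.is_group)
  note S = A.gdiff_rules Rg ag Rm amm
  show ?thesis
  proof
    fix c assume "c \<in> B2_RBE H RH A R a"
    then obtain \<theta> where th: "\<theta> \<in> C1 H A" and
      c: "c = (delta1 H A a \<theta>, \<lambda>h\<in>carrier H. inv\<^bsub>A\<^esub> (Phi1 H RH A R a \<theta> h))"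
      by (auto simp: B2_RBE_def)
    have thc [simp]: "\<theta> h \<in> carrier A" if "h \<in> carrier H" for h
      using th that by (auto simp: C1_def)
    have th1: "\<theta> \<one>\<^bsub>H\<^esub> = \<one>\<^bsub>A\<^esub>" using th by (simp add: C1_def)
    define g where "g = (\<lambda>h\<in>carrier H. inv\<^bsub>A\<^esub> (Phi1 H RH A R a \<theta> h))"
    have g: "g h = gdiff A (\<theta> (RH h)) (R (a (RH h) (\<theta> h)))" if "h \<in> carrier H" for h
      using that by (simp add: g_def Phi1_def S)
    have d: "delta1 H A a \<theta> (h, k) = gdiff A (\<theta> k \<otimes>\<^bsub>A\<^esub> a k (\<theta> h)) (\<theta> (h \<otimes>\<^bsub>H\<^esub> k))"
      if "h \<in> carrier H" "k \<in> carrier H" for h k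
      using that by (simp add: delta1_def S A.m_comm)
    have "delta1 H A a \<theta> \<in> C2 H A"
      by (auto simp: C2_def d A.gdiff_rules th1 aone a1) (auto simp: delta1_def split: if_splits)
    moreover have "g \<in> C1 H A"
      by (auto simp: C1_def g A.gdiff_rules RH1 th1 aone R1) (auto simp: g_def split: if_splits)
    moreover have "delta1 H A a \<theta> (h, k \<otimes>\<^bsub>H\<^esub> l) \<otimes>\<^bsub>A\<^esub> delta1 H A a \<theta> (k, l)
        \<otimes>\<^bsub>A\<^esub> inv\<^bsub>A\<^esub> (delta1 H A a \<theta> (h \<otimes>\<^bsub>H\<^esub> k, l)) \<otimes>\<^bsub>A\<^esub> inv\<^bsub>A\<^esub> (a l (delta1 H A a \<theta> (h, k))) = \<one>\<^bsub>A\<^esub>"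
      if "h \<in> carrier H" "k \<in> carrier H" "l \<in> carrier H" for h k l
      using that by (simp add: d S am H.m_assoc A.m_ac)
    moreover have "partial1 H RH A a g (h, k)
        \<otimes>\<^bsub>A\<^esub> inv\<^bsub>A\<^esub> (R (a (RH k) (a k (g h) \<otimes>\<^bsub>A\<^esub> inv\<^bsub>A\<^esub> (g h))))
        \<otimes>\<^bsub>A\<^esub> inv\<^bsub>A\<^esub> (Phi2 H RH A R a (delta1 H A a \<theta>) (h, k)) = \<one>\<^bsub>A\<^esub>"
      if [simp]: "h \<in> carrier H" "k \<in> carrier H" for h k
    proof -
      define r s where "r = RH h" and "s = RH k"
      have [simp]: "r \<in> carrier H" "s \<in> carrier H" by (simp_all add: r_def s_def)
      define z where "z = a r (\<theta> h)"
      have [simp]: "z \<in> carrier A" by (simp add: z_def)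
      have e1: "h \<otimes>\<^bsub>H\<^esub> r \<otimes>\<^bsub>H\<^esub> (k \<otimes>\<^bsub>H\<^esub> inv\<^bsub>H\<^esub> r) = rb_circ H RH h k"
        by (simp add: rb_circ_def r_def H.m_assoc)
      have aa: "a s (a r (a (inv\<^bsub>H\<^esub> r) x)) = a s x" "a (inv\<^bsub>H\<^esub> r) (a r x) = x" "a r (a (inv\<^bsub>H\<^esub> r) x) = x" if "x \<in> carrier A" for x
        using that by (simp_all add: am[symmetric] a1 )
      have m: "R (a s (a k z)) \<otimes>\<^bsub>A\<^esub> R (a s (a k (R z))) = a s (R z) \<otimes>\<^bsub>A\<^esub> R (a s (R z))"
        using md[of k z] by (simp add: s_def[symmetric] S A.gdiff_rules) (simp add: gdiff_def A.inv_solve_right')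
      have m': "R (a s (a k z)) \<otimes>\<^bsub>A\<^esub> (R (a s (a k (R z))) \<otimes>\<^bsub>A\<^esub> x) = a s (R z) \<otimes>\<^bsub>A\<^esub> (R (a s (R z)) \<otimes>\<^bsub>A\<^esub> x)" if "x \<in> carrier A" for x
        using m that by (simp add: A.m_assoc[symmetric])
      show ?thesis
        apply (simp add: partial1_def Phi2_def RHm g r_def[symmetric] s_def[symmetric] d S am e1 H.m_assoc aa th1 aone R1)
        apply (simp add: z_def[symmetric] aa)
        apply (simp add: A.m_ac m m')
        done
    qed
    ultimately show "c \<in> Z2_RBE H RH A R a"
      by (auto simp: Z2_RBE_def c g_def)
  qed
qed


lemma rb_operator_central_mult:
  assumes "rota_baxter_group I RI" "RI ` center I \<subseteq> center I" "x \<in> center I" "y \<in> carrier I"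
  shows "RI (x \<otimes>\<^bsub>I\<^esub> y) = RI x \<otimes>\<^bsub>I\<^esub> RI y"
proof -
  interpret group I using assms(1) by (simp add: rota_baxter_group_def)
  have x: "x \<in> carrier I" "RI x \<in> center I" "RI x \<in> carrier I" 
    using assms by (auto simp: center_def)
  have "x \<otimes>\<^bsub>I\<^esub> RI x \<otimes>\<^bsub>I\<^esub> y = x \<otimes>\<^bsub>I\<^esub> y \<otimes>\<^bsub>I\<^esub> RI x"
  proof -
    have "RI x \<otimes>\<^bsub>I\<^esub> y = y \<otimes>\<^bsub>I\<^esub> RI x" using x(2) assms(4) by (auto simp: center_def)
    thus ?thesis using x assms(4) by (simp only: m_assoc)
  qed
  hence "rb_circ I RI x y = x \<otimes>\<^bsub>I\<^esub> y"
    using x assms(4) by (simp add: rb_circ_def) (simp add: m_assoc)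
  thus ?thesis using assms x by (simp add: rota_baxter_group_def)
qed

lemma B2_RBE_subset_Z2_RBE:
  fixes H :: "('h, 'm) monoid_scheme" and I :: "('i, 'n) monoid_scheme"
  assumes rH: "rota_baxter_group H RH" and rI: "rota_baxter_group I RI"
    and Z: "RI ` center I \<subseteq> center I"
    and ne: "coupled_triplets H RH I RI \<alpha> \<noteq> {}"
  shows "B2_RBE H RH (center_group I) RI (coupling_action \<alpha>)
         \<subseteq> Z2_RBE H RH (center_group I) RI (coupling_action \<alpha>)"
proof -
  interpret I: group I using rI by (simp add: rota_baxter_group_def)
  interpret H: group H using rH by (simp add: rota_baxter_group_def)
  interpret Z: subgroup "center I" I
  proof
    fix x y assume "x \<in> center I" "y \<in> center I"
    hence c: "x \<in> carrier I" "y \<in> carrier I"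
      and x: "\<And>w. w \<in> carrier I \<Longrightarrow> x \<otimes>\<^bsub>I\<^esub> w = w \<otimes>\<^bsub>I\<^esub> x"
      and y: "\<And>w. w \<in> carrier I \<Longrightarrow> y \<otimes>\<^bsub>I\<^esub> w = w \<otimes>\<^bsub>I\<^esub> y" by (auto simp: center_def)
    have "x \<otimes>\<^bsub>I\<^esub> y \<otimes>\<^bsub>I\<^esub> w = w \<otimes>\<^bsub>I\<^esub> (x \<otimes>\<^bsub>I\<^esub> y)" if "w \<in> carrier I" for w
    proof -
      have "x \<otimes>\<^bsub>I\<^esub> y \<otimes>\<^bsub>I\<^esub> w = x \<otimes>\<^bsub>I\<^esub> w \<otimes>\<^bsub>I\<^esub> y" using c that y[OF that] by (simp only: I.m_assoc)
      thus ?thesis using c that x[OF that] by (simp only: I.m_assoc)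
    qed
    thus "x \<otimes>\<^bsub>I\<^esub> y \<in> center I" using c by (auto simp: center_def)
  next
    fix x assume x: "x \<in> center I"
    have "inv\<^bsub>I\<^esub> x \<otimes>\<^bsub>I\<^esub> y = y \<otimes>\<^bsub>I\<^esub> inv\<^bsub>I\<^esub> x" if "y \<in> carrier I" for y
    proof -
      have c: "x \<in> carrier I" and e: "x \<otimes>\<^bsub>I\<^esub> y = y \<otimes>\<^bsub>I\<^esub> x" using x that by (auto simp: center_def)
      have "inv\<^bsub>I\<^esub> x \<otimes>\<^bsub>I\<^esub> y \<otimes>\<^bsub>I\<^esub> x = inv\<^bsub>I\<^esub> x \<otimes>\<^bsub>I\<^esub> (x \<otimes>\<^bsub>I\<^esub> y)"
        using c that by (simp only: e I.m_assoc I.inv_closed)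
      also have "\<dots> = y" using c that by (simp add: I.m_assoc[symmetric])
      finally show ?thesis using c that by (simp add: I.inv_solve_right)
    qed
    thus "inv\<^bsub>I\<^esub> x \<in> center I" using x by (simp add: center_def)
  qed (auto simp: center_def)
  have zc: "z \<otimes>\<^bsub>I\<^esub> y = y \<otimes>\<^bsub>I\<^esub> z" if "z \<in> center I" "y \<in> carrier I" for z y
    using that unfolding center_def by blast
  define A where "A = center_group I"
  have Ac: "carrier A = center I" and Am: "monoid.mult A = monoid.mult I" "one A = one I"
    by (simp_all add: A_def center_group_def)
  have gA: "group A" unfolding A_def center_group_def by (rule Z.subgroup_is_group) (rule I.is_group)
  have cA: "comm_group A"
    by (rule group.group_comm_groupI[OF gA]) (unfold Ac Am, unfold center_def, blast)
  have Ai: "inv\<^bsub>A\<^esub> x = inv\<^bsub>I\<^esub> x" if "x \<in> center I" for x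
    using that by (metis A_def I.m_inv_consistent Z.subgroup_axioms center_group_def)
  obtain \<mu> \<tau> g where t: "(\<mu>, \<tau>, g) \<in> associated_triplets H RH I RI"
    and ma: "\<And>h. h \<in> carrier H \<Longrightarrow> Inn I #>\<^bsub>AutoGroup I\<^esub> \<mu> h = \<alpha> h"
    using ne unfolding coupled_triplets_def by blast
  note t' = t[unfolded associated_triplets_def mem_Collect_eq prod.case]
  have mu: "\<mu> h \<in> auto I" if "h \<in> carrier H" for h
    by (rule PiE_mem[OF t'[THEN conjunct1] that])
  have ta: "\<tau> (h, k) \<in> carrier I" if "h \<in> carrier H" "k \<in> carrier H" for h k
    by (rule PiE_mem[OF t'[THEN conjunct2, THEN conjunct1]]) (use that in simp)
  have gc: "g h \<in> carrier I" if "h \<in> carrier H" for h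
    by (rule PiE_mem[OF t'[THEN conjunct2, THEN conjunct2, THEN conjunct1] that])
  have ta1: "\<tau> (h, \<one>\<^bsub>H\<^esub>) = \<one>\<^bsub>I\<^esub>" "\<tau> (\<one>\<^bsub>H\<^esub>, h) = \<one>\<^bsub>I\<^esub>" if "h \<in> carrier H" for h
    using bspec[OF t'[THEN conjunct2, THEN conjunct2, THEN conjunct2, THEN conjunct1] that] by simp_all
  have g1: "g \<one>\<^bsub>H\<^esub> = \<one>\<^bsub>I\<^esub>" by (rule t'[THEN conjunct2, THEN conjunct2, THEN conjunct2, THEN conjunct2, THEN conjunct1])
  have T1: "\<mu> (h \<otimes>\<^bsub>H\<^esub> k) y = inner_auto I (\<tau> (h, k)) (\<mu> k (\<mu> h y))"
    if "h \<in> carrier H" "k \<in> carrier H" "y \<in> carrier I" for h k y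
    by (rule t'[THEN conjunct2, THEN conjunct2, THEN conjunct2, THEN conjunct2, THEN conjunct2, THEN conjunct1, THEN bspec, THEN bspec, THEN bspec, OF that])
  have T3: "triplet_rb_condition H RH I RI (\<mu>, \<tau>, g) h k y z"
    if "h \<in> carrier H" "k \<in> carrier H" "y \<in> carrier I" "z \<in> carrier I" for h k y z
    by (rule t'[THEN conjunct2, THEN conjunct2, THEN conjunct2, THEN conjunct2, THEN conjunct2, THEN conjunct2, THEN conjunct2, THEN bspec, THEN bspec, THEN bspec, THEN bspec, OF that])
  have muc: "\<mu> h y \<in> carrier I" if "h \<in> carrier H" "y \<in> carrier I" for h y
    using mu[OF that(1)] that by (auto simp: auto_def hom_def)
  have mum: "\<mu> h (y \<otimes>\<^bsub>I\<^esub> z) = \<mu> h y \<otimes>\<^bsub>I\<^esub> \<mu> h z" if "h \<in> carrier H" "y \<in> carrier I" "z \<in> carrier I" for h y z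
    using mu[OF that(1)] that by (auto simp: auto_def hom_def)
  have muz: "\<mu> h z \<in> center I" if "h \<in> carrier H" "z \<in> center I" for h z
  proof -
    have "\<mu> h z \<otimes>\<^bsub>I\<^esub> y = y \<otimes>\<^bsub>I\<^esub> \<mu> h z" if y: "y \<in> carrier I" for y
    proof -
      have "\<mu> h ` carrier I = carrier I" 
        using mu[OF \<open>h \<in> carrier H\<close>] by (auto simp: auto_def Bij_def bij_betw_def)
      then obtain x where x: "x \<in> carrier I" "y = \<mu> h x" using y by blast
      have "z \<otimes>\<^bsub>I\<^esub> x = x \<otimes>\<^bsub>I\<^esub> z" "z \<in> carrier I"
        using x(1) \<open>z \<in> center I\<close> unfolding center_def by blast+
      thus ?thesis using x mum[OF \<open>h \<in> carrier H\<close>, of x z] mum[OF \<open>h \<in> carrier H\<close>, of z x] by metis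
    qed
    thus ?thesis unfolding center_def using muc[OF that(1) Z.mem_carrier[OF that(2)]] by blast
  qed
  have inz: "inner_auto I x z = z" if "x \<in> carrier I" "z \<in> center I" for x z
  proof -
    have "z \<in> carrier I" "z \<otimes>\<^bsub>I\<^esub> x = x \<otimes>\<^bsub>I\<^esub> z" using that(1) zc[OF that(2,1)] Z.mem_carrier[OF that(2)] by blast+
    hence "x \<otimes>\<^bsub>I\<^esub> z \<otimes>\<^bsub>I\<^esub> inv\<^bsub>I\<^esub> x = z" using that(1)
      by (metis I.inv_closed I.m_assoc I.r_inv I.r_one)
    thus ?thesis using that by (simp add: inner_auto_def)
  qed
  have inauto: "inner_auto I x \<in> Bij (carrier I)" if x: "x \<in> carrier I" for x
  proof -
    have c: "inner_auto I x y \<in> carrier I" if "x \<in> carrier I" "y \<in> carrier I" for x y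
      using that by (simp add: inner_auto_def)
    have e: "x \<otimes>\<^bsub>I\<^esub> (inv\<^bsub>I\<^esub> x \<otimes>\<^bsub>I\<^esub> y) = y" "inv\<^bsub>I\<^esub> x \<otimes>\<^bsub>I\<^esub> (x \<otimes>\<^bsub>I\<^esub> y) = y" if "y \<in> carrier I" for y
      using that x by (simp_all add: I.m_assoc[symmetric])
    have i: "inner_auto I (inv\<^bsub>I\<^esub> x) (inner_auto I x y) = y" "inner_auto I x (inner_auto I (inv\<^bsub>I\<^esub> x) y) = y"
      if "y \<in> carrier I" for y
      using that x by (simp_all add: inner_auto_def I.m_assoc e)
    have "bij_betw (inner_auto I x) (carrier I) (carrier I)"
      by (rule bij_betwI[where g = "inner_auto I (inv\<^bsub>I\<^esub> x)"]) (use x in \<open>auto simp: c i\<close>)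
    thus ?thesis by (auto simp: Bij_def inner_auto_def)
  qed
  have act: "coupling_action \<alpha> h z = \<mu> h z" if hz: "h \<in> carrier H" "z \<in> center I" for h z
  proof -
    have "f z = \<mu> h z" if "f \<in> \<alpha> h" for f
    proof -
      from that obtain x where x: "x \<in> carrier I" "f = inner_auto I x \<otimes>\<^bsub>AutoGroup I\<^esub> \<mu> h"
        unfolding ma[OF hz(1), symmetric] r_coset_def Inn_def by auto
      have "f = compose (carrier I) (inner_auto I x) (\<mu> h)"
        using x inauto mu[OF hz(1)] by (simp add: AutoGroup_def BijGroup_def auto_def)
      thus ?thesis using hz x inz muz by (simp add: compose_def)
    qed
    moreover have "\<alpha> h \<noteq> {}"
      unfolding ma[OF hz(1), symmetric] r_coset_def Inn_def by auto
    ultimately have "(\<lambda>f. f z) ` \<alpha> h = {\<mu> h z}" by force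
    thus ?thesis by (simp add: coupling_action_def)
  qed
  have RIc: "RI y \<in> carrier I" if "y \<in> carrier I" for y
    using rI that by (auto simp: rota_baxter_group_def)
  have RIz: "RI y \<in> center I" if "y \<in> center I" for y using Z that by blast
  have RHc [simp]: "RH h \<in> carrier H" if "h \<in> carrier H" for h
    using rH that by (auto simp: rota_baxter_group_def)
  have RH1: "RH \<one>\<^bsub>H\<^esub> = \<one>\<^bsub>H\<^esub>"
  proof -
    have "RH \<one>\<^bsub>H\<^esub> \<otimes>\<^bsub>H\<^esub> RH \<one>\<^bsub>H\<^esub> = RH (rb_circ H RH \<one>\<^bsub>H\<^esub> \<one>\<^bsub>H\<^esub>)"
      using rH by (auto simp: rota_baxter_group_def)
    thus ?thesis by (simp add: rb_circ_def)
  qed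
  have mu1: "\<mu> \<one>\<^bsub>H\<^esub> y = y" if y: "y \<in> carrier I" for y
  proof -
    have "\<mu> \<one>\<^bsub>H\<^esub> (\<mu> \<one>\<^bsub>H\<^esub> y) = \<mu> \<one>\<^bsub>H\<^esub> y"
      using T1[of "\<one>\<^bsub>H\<^esub>" "\<one>\<^bsub>H\<^esub>" y] y by (simp add: ta1 inner_auto_def muc)
    moreover have "inj_on (\<mu> \<one>\<^bsub>H\<^esub>) (carrier I)"
      using mu[of "\<one>\<^bsub>H\<^esub>"] by (auto simp: auto_def Bij_def bij_betw_def)
    ultimately show ?thesis using y muc by (auto simp: inj_on_def)
  qed
  have cj: "inv\<^bsub>I\<^esub> y \<otimes>\<^bsub>I\<^esub> z \<otimes>\<^bsub>I\<^esub> y = z" if "z \<in> center I" "y \<in> carrier I" for z y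
    using that zc[OF that] by (metis I.inv_closed I.l_inv I.l_one I.m_assoc Z.mem_carrier)
  have md: "RI (\<mu> (RH h) (\<mu> h (z \<otimes>\<^bsub>I\<^esub> RI z) \<otimes>\<^bsub>I\<^esub> inv\<^bsub>I\<^esub> (RI z))) = \<mu> (RH h) (RI z)"
    if h: "h \<in> carrier H" and z: "z \<in> center I" for h z
  proof -
    have zI: "z \<in> carrier I" using z by simp
    define w where "w = \<mu> h (z \<otimes>\<^bsub>I\<^esub> RI z) \<otimes>\<^bsub>I\<^esub> inv\<^bsub>I\<^esub> (RI z)"
    have w: "w \<in> center I" using h z muz RIz by (simp add: w_def)
    have R1: "RI \<one>\<^bsub>I\<^esub> = \<one>\<^bsub>I\<^esub>"
      using rb_operator_central_mult[OF rI Z, of "\<one>\<^bsub>I\<^esub>" "\<one>\<^bsub>I\<^esub>"] RIc by simp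
    have m1: "\<mu> k \<one>\<^bsub>I\<^esub> = \<one>\<^bsub>I\<^esub>" if "k \<in> carrier H" for k
      using mum[OF that, of "\<one>\<^bsub>I\<^esub>" "\<one>\<^bsub>I\<^esub>"] muc[OF that, of "\<one>\<^bsub>I\<^esub>"] by simp
    have zz: "z \<otimes>\<^bsub>I\<^esub> RI z \<in> carrier I" using zI RIc by simp
    have f: "h \<otimes>\<^bsub>H\<^esub> \<one>\<^bsub>H\<^esub> = h" "\<one>\<^bsub>H\<^esub> \<otimes>\<^bsub>H\<^esub> h = h" "\<one>\<^bsub>H\<^esub> \<otimes>\<^bsub>H\<^esub> RH h = RH h" "rb_circ H RH \<one>\<^bsub>H\<^esub> h = h"
        "\<mu> \<one>\<^bsub>H\<^esub> z = z" "\<tau> (\<one>\<^bsub>H\<^esub>, RH h) = \<one>\<^bsub>I\<^esub>" "\<tau> (\<one>\<^bsub>H\<^esub>, h) = \<one>\<^bsub>I\<^esub>" "\<tau> (h, \<one>\<^bsub>H\<^esub>) = \<one>\<^bsub>I\<^esub>"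
        "\<tau> (\<one>\<^bsub>H\<^esub>, \<one>\<^bsub>H\<^esub>) = \<one>\<^bsub>I\<^esub>" "\<mu> (RH h) \<one>\<^bsub>I\<^esub> = \<one>\<^bsub>I\<^esub>" "inv\<^bsub>I\<^esub> (g h) \<otimes>\<^bsub>I\<^esub> g h = \<one>\<^bsub>I\<^esub>"
        "inv\<^bsub>I\<^esub> \<one>\<^bsub>I\<^esub> = \<one>\<^bsub>I\<^esub>" "inv\<^bsub>H\<^esub> \<one>\<^bsub>H\<^esub> = \<one>\<^bsub>H\<^esub>" "\<one>\<^bsub>H\<^esub> \<otimes>\<^bsub>H\<^esub> \<one>\<^bsub>H\<^esub> = \<one>\<^bsub>H\<^esub>"
        "\<mu> \<one>\<^bsub>H\<^esub> (inv\<^bsub>I\<^esub> (RI z)) = inv\<^bsub>I\<^esub> (RI z)"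
      using h zI gc[OF h] RIc[OF zI] by (simp_all add: mu1 ta1 m1 rb_circ_def RH1)
    have f2: "\<one>\<^bsub>I\<^esub> \<otimes>\<^bsub>I\<^esub> x = x" "x \<otimes>\<^bsub>I\<^esub> \<one>\<^bsub>I\<^esub> = x" if "x \<in> carrier I" for x
      using that by simp_all
    have c: "z \<otimes>\<^bsub>I\<^esub> RI z \<in> carrier I" "RI z \<in> carrier I" "inv\<^bsub>I\<^esub> RI z \<in> carrier I" "\<one>\<^bsub>I\<^esub> \<in> carrier I" "inv\<^bsub>I\<^esub> (g h) \<in> carrier I"
      "\<mu> h (z \<otimes>\<^bsub>I\<^esub> RI z) \<in> carrier I" "\<mu> (RH h) (RI z) \<in> carrier I" "w \<in> carrier I"
      "\<mu> (RH h) (RI z) \<otimes>\<^bsub>I\<^esub> g h \<in> carrier I"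
      using zI h w gc[OF h] RIc[OF zI] zz by (simp_all add: muc)
    have "g h \<otimes>\<^bsub>I\<^esub> RI (\<mu> (RH h) w) = \<mu> (RH h) (RI z) \<otimes>\<^bsub>I\<^esub> g h"
      using T3[OF H.one_closed h zI I.one_closed, unfolded triplet_rb_condition_def Let_def prod.case]
      by (simp only: RH1 g1 f f2 zI gc[OF h] R1 c w_def[symmetric] cj[OF muz[OF RHc[OF h] w] gc[OF h]])
    hence q: "g h \<otimes>\<^bsub>I\<^esub> RI (\<mu> (RH h) w) = g h \<otimes>\<^bsub>I\<^esub> \<mu> (RH h) (RI z)"
      by (simp only: zc[OF muz[OF RHc[OF h] RIz[OF z]] gc[OF h]])
    show ?thesis unfolding w_def[symmetric]
      by (rule I.l_cancel[OF q RIc[OF muc[OF RHc[OF h] c(8)]] c(7) gc[OF h]])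
  qed
  have "B2_RBE H RH A RI (coupling_action \<alpha>) \<subseteq> Z2_RBE H RH A RI (coupling_action \<alpha>)"
  proof (rule rb_coboundaries_are_cocycles[OF cA rH])
    show "RI \<in> hom A A" using rb_operator_central_mult[OF rI Z] RIz by (auto simp: hom_def Ac Am)
    show "coupling_action \<alpha> h \<in> hom A A" if "h \<in> carrier H" for h
      using that muz by (auto simp: hom_def Ac Am act mum)
    show "coupling_action \<alpha> (h \<otimes>\<^bsub>H\<^esub> k) z = coupling_action \<alpha> k (coupling_action \<alpha> h z)"
      if "h \<in> carrier H" "k \<in> carrier H" "z \<in> carrier A" for h k z
      using that by (simp add: Ac act muz T1 ta inz)
    show "coupling_action \<alpha> \<one>\<^bsub>H\<^esub> z = z" if "z \<in> carrier A" for z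
      using that by (simp add: Ac act mu1)
    show "RI (coupling_action \<alpha> (RH h) (coupling_action \<alpha> h (z \<otimes>\<^bsub>A\<^esub> RI z) \<otimes>\<^bsub>A\<^esub> inv\<^bsub>A\<^esub> (RI z)))
        = coupling_action \<alpha> (RH h) (RI z)" if "h \<in> carrier H" "z \<in> carrier A" for h z
      using that md by (simp add: Ac Am Ai act muz RIz)
  qed
  thus ?thesis by (simp add: A_def)
qed

text \<open>
  By the preceding lemma the intersection below is just \<open>B2_RBE\<close> as soon as a triplet with
  coupling \<open>\<alpha>\<close> exists. Without such a triplet \<open>\<alpha>\<close> may fail to make the center an
  \<open>(H, RH)\<close>-module, and the intersection only serves to have a group in that case too.
\<close>

definition H2_RBE ::
  "('h, 'm) monoid_scheme \<Rightarrow> ('h \<Rightarrow> 'h) \<Rightarrow> ('a, 'n) monoid_scheme \<Rightarrow> ('a \<Rightarrow> 'a) \<Rightarrow>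
   ('h \<Rightarrow> 'a \<Rightarrow> 'a) \<Rightarrow> (('h \<times> 'h \<Rightarrow> 'a) \<times> ('h \<Rightarrow> 'a)) set monoid" where
  "H2_RBE H RH A R a =
     ((C2_group H A \<times>\<times> C1_group H A)\<lparr>carrier := Z2_RBE H RH A R a\<rparr>)
       Mod (B2_RBE H RH A R a \<inter> Z2_RBE H RH A R a)"

end

theory Submission
  imports Defs
begin

text \<open>
  A cocycle \<open>(f, k)\<close> acts on triplets by \<open>(\<mu>, \<tau>, g) \<mapsto> (\<mu>, \<tau> f, g k\<^sup>-\<^sup>1)\<close>. As \<open>f\<close> and \<open>k\<close> are central
  and \<open>RI\<close> is multiplicative on products with a central factor, the change of both sides of each
  triplet condition is a central factor, and the cocycle conditions say exactly that these factors
  agree. Every equivalence of triplet extensions has the form \<open>(h, y) \<mapsto> (h, \<theta> h \<otimes> y)\<close>, and the same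
  \<open>\<theta>\<close> relates the shifted triplets, so the action descends to classes. If a shifted triplet is
  equivalent to the original one, then \<open>\<mu>\<close> is unchanged and surjective, which forces \<open>\<theta>\<close> to be
  central; the equations for \<open>\<theta>\<close> then state that \<open>(f, k)\<close> is the coboundary of \<open>\<theta>\<close>.
\<close>

section \<open>Actions on quotients and equivalence of extensions\<close>

text \<open>The hypotheses do not provide a triplet with coupling \<alpha>, yet the acting group has
  to be a group in every case. The cocycles, the coboundaries and their intersection are therefore
  handled using only that each \<open>act h\<close> and \<open>RI\<close> are homomorphisms on the
  centre. The composition law of \<open>act\<close> enters once a triplet supplies it.

  In the third triplet condition \<open>g\<close> enters \<open>RI\<close>, apart from
  \<open>w\<close>, only through conjugation, which a central factor does not change. Inside
  \<open>w\<close> the element \<open>g h1\<close> and its inverse occur under different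
  automorphisms, so their central factors do not cancel; what remains is the origin of the term
  \<open>R (a (RH h2) (a h2 (g h1) \<otimes> inv (g h1)))\<close> in \<open>Z2_RBE\<close>.

  Shifting is an action of the whole cocycle group on triplets themselves, not only up to
  equivalence, and the cocycles that keep a triplet in its class form the same subgroup for every
  triplet. This uniformity makes the action on classes both well defined on cosets and free.\<close>

lemma free_action_on_quotient:
  assumes N: "N \<lhd> K" and r: "equiv E r"
    and closed: "\<And>k x. k \<in> carrier K \<Longrightarrow> x \<in> E \<Longrightarrow> act k x \<in> E"
    and mult: "\<And>k l x. k \<in> carrier K \<Longrightarrow> l \<in> carrier K \<Longrightarrow> x \<in> E \<Longrightarrow>
      act (k \<otimes>\<^bsub>K\<^esub> l) x = act k (act l x)"
    and one: "\<And>x. x \<in> E \<Longrightarrow> act \<one>\<^bsub>K\<^esub> x = x"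
    and cong: "\<And>k x y. k \<in> carrier K \<Longrightarrow> (x, y) \<in> r \<Longrightarrow> (act k x, act k y) \<in> r"
    and free: "\<And>k x. k \<in> carrier K \<Longrightarrow> x \<in> E \<Longrightarrow> (act k x, x) \<in> r \<longleftrightarrow> k \<in> N"
  shows "\<exists>\<phi>. group_action (K Mod N) (E // r) \<phi> \<and>
    (\<forall>C \<in> (E // r). stabilizer (K Mod N) \<phi> C = {\<one>\<^bsub>(K Mod N)\<^esub>})"
proof -
  interpret N: normal N K by fact
  \<comment> \<open>A union over all representatives of the coset and of the class avoids choosing
    any; it turns out to be a single class. The restriction to \<open>E // r\<close> is there
    because \<open>Bij\<close> asks for extensional maps.\<close>
  define \<phi> where "\<phi> D = (\<lambda>C\<in>E // r. \<Union>k\<in>D. r `` act k ` C)" for D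
  have cls: "r `` act k ` (r `` {x}) = r `` {act k x}" if k: "k \<in> carrier K" and x: "x \<in> E" for k x
  proof -
    have "r `` {act k y} = r `` {act k x}" if "(x, y) \<in> r" for y
      by (rule equiv_class_eq[OF r, symmetric]) (rule cong[OF k that])
    moreover have "x \<in> r `` {x}" using equiv_class_self[OF r x] .
    ultimately show ?thesis by blast
  qed
  have phi: "\<phi> (N #>\<^bsub>K\<^esub> k) (r `` {x}) = r `` {act k x}" if k: "k \<in> carrier K" and x: "x \<in> E" for k x
  proof -
    have "r `` act l ` (r `` {x}) = r `` {act k x}" if l: "l \<in> N #>\<^bsub>K\<^esub> k" for l
    proof -
      obtain n where n: "n \<in> N" "l = n \<otimes>\<^bsub>K\<^esub> k" using l by (auto simp: r_coset_def)
      have nk: "n \<in> carrier K" using n(1) by simp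
      \<comment> \<open>Freeness is applied at the point \<open>act k x\<close>: the element
        \<open>n\<close> of \<open>N\<close> moves it only within its class. This uses that
        \<open>free\<close> holds with the same \<open>N\<close> at every point.\<close>
      have "(act l x, act k x) \<in> r"
        using free[OF nk closed[OF k x]] n by (simp add: mult[OF nk k x])
      then have "r `` {act l x} = r `` {act k x}" by (rule equiv_class_eq[OF r])
      moreover have "l \<in> carrier K" using n k nk by simp
      ultimately show ?thesis using cls x by simp
    qed
    moreover have "k \<in> N #>\<^bsub>K\<^esub> k" by (rule N.rcos_self[OF k N.subgroup_axioms])
    moreover have "r `` {x} \<in> E // r" using x by (rule quotientI)
    ultimately show ?thesis unfolding \<phi>_def by auto
  qed
  have carr: "\<exists>k\<in>carrier K. D = N #>\<^bsub>K\<^esub> k" if "D \<in> carrier (K Mod N)" for D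
    using that by (auto simp: FactGroup_def RCOSETS_def)
  have clsE: "r `` {act k x} \<in> E // r" if "k \<in> carrier K" "x \<in> E" for k x
    using closed[OF that] by (rule quotientI)
  have inv_phi: "\<phi> (N #>\<^bsub>K\<^esub> inv\<^bsub>K\<^esub> k) (\<phi> (N #>\<^bsub>K\<^esub> k) C) = C"
      "\<phi> (N #>\<^bsub>K\<^esub> k) (\<phi> (N #>\<^bsub>K\<^esub> inv\<^bsub>K\<^esub> k) C) = C"
      "\<phi> (N #>\<^bsub>K\<^esub> k) C \<in> E // r"
    if k: "k \<in> carrier K" and C: "C \<in> E // r" for k C
  proof -
    obtain x where x: "x \<in> E" "C = r `` {x}" using C by (rule quotientE)
    show "\<phi> (N #>\<^bsub>K\<^esub> inv\<^bsub>K\<^esub> k) (\<phi> (N #>\<^bsub>K\<^esub> k) C) = C"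
      "\<phi> (N #>\<^bsub>K\<^esub> k) (\<phi> (N #>\<^bsub>K\<^esub> inv\<^bsub>K\<^esub> k) C) = C" "\<phi> (N #>\<^bsub>K\<^esub> k) C \<in> E // r"
      using k x by (simp_all add: phi closed mult[symmetric] one clsE)
  qed
  have bij: "\<phi> D \<in> Bij (E // r)" if D: "D \<in> carrier (K Mod N)" for D
  proof -
    obtain k where k: "k \<in> carrier K" "D = N #>\<^bsub>K\<^esub> k" using carr[OF D] by blast
    have "bij_betw (\<phi> D) (E // r) (E // r)"
      by (rule bij_betwI[where g = "\<phi> (N #>\<^bsub>K\<^esub> inv\<^bsub>K\<^esub> k)"])
        (use k inv_phi N.inv_closed in auto)
    then show ?thesis by (simp add: Bij_def \<phi>_def)
  qed
  have hom: "\<phi> (D \<otimes>\<^bsub>(K Mod N)\<^esub> D') = compose (E // r) (\<phi> D) (\<phi> D')"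
    if D: "D \<in> carrier (K Mod N)" "D' \<in> carrier (K Mod N)" for D D'
  proof (rule extensionalityI)
    obtain k l where k: "k \<in> carrier K" "D = N #>\<^bsub>K\<^esub> k" and l: "l \<in> carrier K" "D' = N #>\<^bsub>K\<^esub> l"
      using carr D by metis
    fix C assume C: "C \<in> E // r"
    then obtain x where x: "x \<in> E" "C = r `` {x}" by (rule quotientE)
    show "\<phi> (D \<otimes>\<^bsub>(K Mod N)\<^esub> D') C = compose (E // r) (\<phi> D) (\<phi> D') C"
      using k l x C by (simp add: compose_def N.rcos_sum phi mult closed)
  qed (simp_all add: \<phi>_def)
  have "group_action (K Mod N) (E // r) \<phi>"
    unfolding group_action_def group_hom_def group_hom_axioms_def
    using bij hom N.factorgroup_is_group group_BijGroup by (auto simp: hom_def BijGroup_def)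
  moreover have "stabilizer (K Mod N) \<phi> C = {\<one>\<^bsub>(K Mod N)\<^esub>}" if C: "C \<in> E // r" for C
  proof -
    obtain x where x: "x \<in> E" "C = r `` {x}" using C by (rule quotientE)
    have "\<phi> D C = C \<longleftrightarrow> D = N" if D: "D \<in> carrier (K Mod N)" for D
    proof -
      obtain k where k: "k \<in> carrier K" "D = N #>\<^bsub>K\<^esub> k" using carr[OF D] by blast
      have "\<phi> D C = C \<longleftrightarrow> (act k x, x) \<in> r"
        using k x by (simp add: phi eq_equiv_class_iff[OF r] closed)
      also have "\<dots> \<longleftrightarrow> k \<in> N" by (rule free[OF k(1) x(1)])
      also have "\<dots> \<longleftrightarrow> D = N"
        using N.coset_join1[OF _ k(1) N.subgroup_axioms] N.coset_join2[OF k(1) N.subgroup_axioms]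
          k N.subset by blast
      finally show ?thesis .
    qed
    moreover have "N \<in> carrier (K Mod N)"
      using group.is_monoid[OF N.factorgroup_is_group, THEN monoid.one_closed] by simp
    ultimately show ?thesis by (auto simp: stabilizer_def)
  qed
  ultimately show ?thesis by blast
qed

section \<open>Equivalence of Rota-Baxter extensions\<close>

lemma rb_extension_equiv_sym:
  assumes "rb_extension_equiv H RH I RI E RE \<iota> \<pi> E' RE' \<iota>' \<pi>'"
  shows "rb_extension_equiv H RH I RI E' RE' \<iota>' \<pi>' E RE \<iota> \<pi>"
proof -
  obtain F where ext: "rb_extension H RH I RI E RE \<iota> \<pi>" "rb_extension H RH I RI E' RE' \<iota>' \<pi>'"
    and F: "F \<in> iso E E'" "F \<in> rb_hom E RE E' RE'"
      "\<And>y. y \<in> carrier I \<Longrightarrow> F (\<iota> y) = \<iota>' y" "\<And>e. e \<in> carrier E \<Longrightarrow> \<pi>' (F e) = \<pi> e"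
    using assms by (auto simp: rb_extension_equiv_def)
  have E: "group E" and RE: "RE e \<in> carrier E" if "e \<in> carrier E" for e
    using ext that by (auto simp: rb_extension_def rota_baxter_group_def)
  have io: "\<iota> y \<in> carrier E" if "y \<in> carrier I" for y
    using ext that by (auto simp: rb_extension_def rb_hom_def hom_def)
  define F' where "F' = inv_into (carrier E) F"
  have bij: "bij_betw F (carrier E) (carrier E')" using F(1) by (simp add: iso_def)
  have F'F: "F' (F e) = e" if "e \<in> carrier E" for e
    using bij that by (simp add: F'_def bij_betw_inv_into_left)
  have ex: "\<exists>e\<in>carrier E. x = F e" if "x \<in> carrier E'" for x
    using bij that by (auto simp: bij_betw_def)
  have iso': "F' \<in> iso E' E"
  \<comment> \<open>The fact \<open>E\<close> was stated under the premise that
    \<open>carrier E\<close> has an element, so it is available only in the second case; in the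
    first all conditions on \<open>F'\<close> are vacuous.\<close>
  proof (cases "carrier E = {}")
    case True
    then show ?thesis using bij by (simp add: iso_def hom_def bij_betw_def)
  next
    case False
    then show ?thesis using E F(1) unfolding F'_def by (blast intro: group.iso_set_sym)
  qed
  moreover have "F' \<in> rb_hom E' RE' E RE"
  proof -
    have "F' (RE' x) = RE (F' x)" if "x \<in> carrier E'" for x
    proof -
      obtain e where e: "e \<in> carrier E" "x = F e" using ex \<open>x \<in> carrier E'\<close> by blast
      have "RE' x = F (RE e)" using F(2) e by (simp add: rb_hom_def)
      then show ?thesis using e RE by (simp add: F'F)
    qed
    then show ?thesis using iso' by (simp add: rb_hom_def iso_def)
  qed
  moreover have "F' (\<iota>' y) = \<iota> y" if "y \<in> carrier I" for y
    using F'F[OF io[OF that]] F(3)[OF that] by simp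
  moreover have "\<pi> (F' x) = \<pi>' x" if "x \<in> carrier E'" for x
    using ex[OF that] F(4) F'F by auto
  ultimately show ?thesis using ext unfolding rb_extension_equiv_def by blast
qed

lemma rb_extension_equiv_trans:
  assumes "rb_extension_equiv H RH I RI E RE \<iota> \<pi> E' RE' \<iota>' \<pi>'"
    and "rb_extension_equiv H RH I RI E' RE' \<iota>' \<pi>' E'' RE'' \<iota>'' \<pi>''"
  shows "rb_extension_equiv H RH I RI E RE \<iota> \<pi> E'' RE'' \<iota>'' \<pi>''"
proof -
  obtain F where ext: "rb_extension H RH I RI E RE \<iota> \<pi>"
    and F: "F \<in> iso E E'" "F \<in> rb_hom E RE E' RE'"
      "\<And>y. y \<in> carrier I \<Longrightarrow> F (\<iota> y) = \<iota>' y" "\<And>e. e \<in> carrier E \<Longrightarrow> \<pi>' (F e) = \<pi> e"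
    using assms(1) by (auto simp: rb_extension_equiv_def)
  obtain F' where ext': "rb_extension H RH I RI E'' RE'' \<iota>'' \<pi>''"
    and F': "F' \<in> iso E' E''" "F' \<in> rb_hom E' RE' E'' RE''"
      "\<And>y. y \<in> carrier I \<Longrightarrow> F' (\<iota>' y) = \<iota>'' y" "\<And>e. e \<in> carrier E' \<Longrightarrow> \<pi>'' (F' e) = \<pi>' e"
    using assms(2) by (auto simp: rb_extension_equiv_def)
  have c: "F e \<in> carrier E'" if "e \<in> carrier E" for e
    using F(2) that by (auto simp: rb_hom_def hom_def)
  have io: "F' \<circ> F \<in> iso E E''" using F(1) F'(1) by (rule iso_set_trans)
  then have "F' \<circ> F \<in> rb_hom E RE E'' RE''"
    using F(2) F'(2) c by (simp add: rb_hom_def iso_def)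
  then show ?thesis
    unfolding rb_extension_equiv_def using io ext ext' F(3,4) F'(3,4) c
    by (intro conjI exI[of _ "F' \<circ> F"]) simp_all
qed

lemma rb_extension_equiv_refl:
  assumes "rb_extension H RH I RI E RE \<iota> \<pi>"
  shows "rb_extension_equiv H RH I RI E RE \<iota> \<pi> E RE \<iota> \<pi>"
  unfolding rb_extension_equiv_def using assms
  by (intro conjI exI[of _ "\<lambda>e. e"]) (auto simp: rb_hom_def iso_def hom_def bij_betw_def)

section \<open>Central factors\<close>

context group
begin

lemma center_commute: "z \<in> center G \<Longrightarrow> x \<in> carrier G \<Longrightarrow> z \<otimes> x = x \<otimes> z"
  by (simp add: center_def)

lemma center_closed: "z \<in> center G \<Longrightarrow> z \<in> carrier G"
  by (simp add: center_def)

lemma centerI: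
  "z \<in> carrier G \<Longrightarrow> (\<And>x. x \<in> carrier G \<Longrightarrow> z \<otimes> x = x \<otimes> z) \<Longrightarrow> z \<in> center G"
  by (simp add: center_def)

lemma subgroup_center: "subgroup (center G) G"
proof
  fix x y assume xy: "x \<in> center G" "y \<in> center G"
  have "x \<otimes> y \<otimes> w = w \<otimes> (x \<otimes> y)" if "w \<in> carrier G" for w
  proof -
    have c: "x \<in> carrier G" "y \<in> carrier G" using xy center_closed by auto
    have "x \<otimes> y \<otimes> w = x \<otimes> w \<otimes> y" using c that by (simp only: m_assoc center_commute[OF xy(2) that])
    also have "\<dots> = w \<otimes> x \<otimes> y" by (simp only: center_commute[OF xy(1) that])
    finally show ?thesis using c that by (simp only: m_assoc)
  qed
  then show "x \<otimes> y \<in> center G" using xy center_closed by (auto intro: centerI)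
next
  fix x assume x: "x \<in> center G"
  have "inv x \<otimes> y = y \<otimes> inv x" if y: "y \<in> carrier G" for y
  proof -
    have "inv x \<otimes> y = inv (inv y \<otimes> x)"
      using y center_closed[OF x] by (simp add: inv_mult_group)
    also have "\<dots> = inv (x \<otimes> inv y)" using center_commute[OF x inv_closed[OF y]] by simp
    also have "\<dots> = y \<otimes> inv x" using y center_closed[OF x] by (simp add: inv_mult_group)
    finally show ?thesis .
  qed
  then show "inv x \<in> center G" using x center_closed by (auto intro: centerI)
qed (auto intro: center_closed centerI)

lemma center_one [simp]: "\<one> \<in> center G"
  and center_mult: "x \<in> center G \<Longrightarrow> y \<in> center G \<Longrightarrow> x \<otimes> y \<in> center G"
  and center_inv: "x \<in> center G \<Longrightarrow> inv x \<in> center G"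
  using subgroup_center by (simp_all add: subgroup_def)

lemma center_group_simps [simp]:
  "carrier (center_group G) = center G"
  "x \<otimes>\<^bsub>center_group G\<^esub> y = x \<otimes> y"
  "\<one>\<^bsub>center_group G\<^esub> = \<one>"
  by (simp_all add: center_group_def)

lemma inv_center_group: "x \<in> center G \<Longrightarrow> inv\<^bsub>center_group G\<^esub> x = inv x"
  unfolding center_group_def by (rule m_inv_consistent[OF subgroup_center])

lemma comm_group_center_group: "comm_group (center_group G)"
proof (rule group.group_comm_groupI)
  show "group (center_group G)"
    unfolding center_group_def using subgroup_center is_group by (rule subgroup.subgroup_is_group)
qed (simp add: center_commute center_closed)

text \<open>This bracketing is the one behind \<open>w\<close> in the third triplet condition: the
  first factor of \<open>w\<close> is the value of \<tau> at the H-components of the two halves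
  \<open>x \<otimes> R x\<close> and \<open>y \<otimes> inv R x\<close>.\<close>

lemma rb_circ_regroup:
  "x \<in> carrier G \<Longrightarrow> R x \<in> carrier G \<Longrightarrow> y \<in> carrier G \<Longrightarrow>
    rb_circ G R x y = x \<otimes> R x \<otimes> (y \<otimes> inv R x)"
  by (simp add: rb_circ_def m_assoc)

text \<open>A marker that lets the simplifier collect central factors on the right.\<close>

definition central_mult :: "'a \<Rightarrow> 'a \<Rightarrow> 'a" where
  "central_mult x z = x \<otimes> z"

lemma central_mult_closed: "x \<in> carrier G \<Longrightarrow> z \<in> center G \<Longrightarrow> central_mult x z \<in> carrier G"
  by (simp add: central_mult_def center_closed)

lemma mult_central_mult:
  "x \<in> carrier G \<Longrightarrow> y \<in> carrier G \<Longrightarrow> z \<in> center G \<Longrightarrow>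
    x \<otimes> central_mult y z = central_mult (x \<otimes> y) z"
  "x \<in> carrier G \<Longrightarrow> y \<in> carrier G \<Longrightarrow> z \<in> center G \<Longrightarrow>
    central_mult y z \<otimes> x = central_mult (y \<otimes> x) z"
  by (simp_all add: central_mult_def center_closed m_assoc center_commute)

lemma central_mult_central_mult:
  "x \<in> carrier G \<Longrightarrow> z \<in> center G \<Longrightarrow> w \<in> center G \<Longrightarrow>
    central_mult (central_mult x z) w = central_mult x (z \<otimes> w)"
  by (simp add: central_mult_def center_closed m_assoc)

lemma inv_central_mult:
  "x \<in> carrier G \<Longrightarrow> z \<in> center G \<Longrightarrow> inv (central_mult x z) = central_mult (inv x) (inv z)"
  by (simp add: central_mult_def inv_mult_group center_closed center_commute center_inv)

lemma central_mult_one: "x \<in> carrier G \<Longrightarrow> central_mult x \<one> = x"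
  by (simp add: central_mult_def)

lemmas central_mult_simps = central_mult_closed mult_central_mult central_mult_central_mult
  inv_central_mult center_mult center_inv

text \<open>The reason why the operator of a triplet sees a central change of \<open>g h\<close>
  only outside \<open>RI\<close>: within the conjugation the factor meets its inverse.\<close>

lemma conj_central_mult:
  assumes "x \<in> carrier G" "y \<in> carrier G" "z \<in> center G"
  shows "inv (central_mult x z) \<otimes> y \<otimes> central_mult x z = inv x \<otimes> y \<otimes> x"
proof -
  have "inv z \<otimes> z = \<one>" using assms center_closed by simp
  then show ?thesis using assms by (simp add: central_mult_simps central_mult_one)
qed

lemma center_ac:
  "x \<in> center G \<Longrightarrow> y \<in> center G \<Longrightarrow> z \<in> center G \<Longrightarrow> x \<otimes> y \<otimes> z = x \<otimes> (y \<otimes> z)"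
  "x \<in> center G \<Longrightarrow> y \<in> center G \<Longrightarrow> x \<otimes> y = y \<otimes> x"
  "x \<in> center G \<Longrightarrow> y \<in> center G \<Longrightarrow> z \<in> center G \<Longrightarrow> x \<otimes> (y \<otimes> z) = y \<otimes> (x \<otimes> z)"
  using comm_group.axioms(1)[OF comm_group_center_group, THEN comm_monoid.m_lcomm]
  by (simp_all add: m_assoc center_closed center_commute)

lemma center_inv_mult:
  "x \<in> center G \<Longrightarrow> y \<in> center G \<Longrightarrow> inv (x \<otimes> y) = inv x \<otimes> inv y"
  using center_ac(2)[OF center_inv center_inv, of y x] by (simp add: inv_mult_group center_closed)

lemma auto_center:
  assumes "f \<in> auto G" "z \<in> center G"
  shows "f z \<in> center G"
proof -
  have f: "f \<in> hom G G" "f ` carrier G = carrier G"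
    using assms(1) by (auto simp: auto_def Bij_def bij_betw_def)
  have "f z \<otimes> y = y \<otimes> f z" if "y \<in> carrier G" for y
  proof -
    \<comment> \<open>Commuting with \<open>y\<close> can be tested on a preimage, so surjectivity
      of \<open>f\<close> is what makes the centre invariant.\<close>
    have "y \<in> f ` carrier G" using that by (simp only: f(2))
    then obtain x where x: "y = f x" "x \<in> carrier G" by (rule imageE)
    have "f z \<otimes> f x = f (z \<otimes> x)" using x hom_mult[OF f(1)] center_closed[OF assms(2)] by simp
    also have "\<dots> = f (x \<otimes> z)" by (simp only: center_commute[OF assms(2) x(2)])
    also have "\<dots> = f x \<otimes> f z" using x hom_mult[OF f(1)] center_closed[OF assms(2)] by simp
    finally show ?thesis by (simp only: x)
  qed
  moreover have "f z \<in> carrier G" using f(1) center_closed[OF assms(2)] by (rule hom_in_carrier)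
  ultimately show ?thesis by (rule centerI[rotated])
qed

lemma inner_auto_center:
  "x \<in> carrier G \<Longrightarrow> z \<in> center G \<Longrightarrow> inner_auto G x z = z"
  using center_commute[of z x, symmetric] by (simp add: inner_auto_def center_closed)
    (simp add: center_closed m_assoc)

lemma inner_auto_Bij:
  assumes x: "x \<in> carrier G"
  shows "inner_auto G x \<in> Bij (carrier G)"
proof -
  have e: "x \<otimes> (inv x \<otimes> y) = y" "inv x \<otimes> (x \<otimes> y) = y" if "y \<in> carrier G" for y
    using that x by (simp_all add: m_assoc[symmetric])
  have "bij_betw (inner_auto G x) (carrier G) (carrier G)"
    by (rule bij_betwI[where g = "inner_auto G (inv x)"])
      (use x in \<open>auto simp: inner_auto_def m_assoc e\<close>)
  then show ?thesis by (simp add: Bij_def inner_auto_def)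
qed

text \<open>An arbitrary representative \<open>f\<close> of the coset is allowed. With the maps of a
  triplet this identifies its action on the centre; with any representative it yields laws of the
  action when no triplet is given.\<close>

lemma coupling_action_eq:
  assumes f: "f \<in> auto G" and al: "Inn G #>\<^bsub>AutoGroup G\<^esub> f = \<alpha> h" and z: "z \<in> center G"
  shows "coupling_action \<alpha> h z = f z"
proof -
  have "k z = f z" if k: "k \<in> \<alpha> h" for k
  proof -
    obtain x where x: "x \<in> carrier G" "k = inner_auto G x \<otimes>\<^bsub>AutoGroup G\<^esub> f"
      using k unfolding al[symmetric] r_coset_def Inn_def by auto
    then have "k = compose (carrier G) (inner_auto G x) f"
      using inner_auto_Bij f by (simp add: AutoGroup_def BijGroup_def auto_def)
    then show ?thesis
      using x f z by (simp add: compose_def center_closed inner_auto_center auto_center)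
  qed
  moreover have "\<alpha> h \<noteq> {}" unfolding al[symmetric] r_coset_def Inn_def by auto
  ultimately have "(\<lambda>k. k z) ` \<alpha> h = {f z}" by force
  then show ?thesis by (simp add: coupling_action_def)
qed

lemma coupling_representative:
  assumes "coupling H G \<alpha>" "h \<in> carrier H"
  shows "\<exists>f\<in>auto G. Inn G #>\<^bsub>AutoGroup G\<^esub> f = \<alpha> h"
proof -
  have "\<alpha> h \<in> carrier (OutGroup G)" using assms by (auto simp: coupling_def)
  then show ?thesis by (auto simp: OutGroup_def FactGroup_def RCOSETS_def AutoGroup_def)
qed

end

section \<open>The extension of a triplet\<close>

locale rota_baxter_groups =
  fixes H :: "('h, 'm) monoid_scheme" and RH :: "'h \<Rightarrow> 'h"
    and I :: "('i, 'n) monoid_scheme" (structure) and RI :: "'i \<Rightarrow> 'i"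
  assumes rota_baxter_H: "rota_baxter_group H RH" and rota_baxter_I: "rota_baxter_group I RI"
begin

sublocale H: group H using rota_baxter_H by (simp add: rota_baxter_group_def)
sublocale I: group I using rota_baxter_I by (simp add: rota_baxter_group_def)

lemma RH_closed [simp]: "h \<in> carrier H \<Longrightarrow> RH h \<in> carrier H"
  using rota_baxter_H by (auto simp: rota_baxter_group_def)

lemma RI_closed [simp]: "y \<in> carrier I \<Longrightarrow> RI y \<in> carrier I"
  using rota_baxter_I by (auto simp: rota_baxter_group_def)

lemma rb_circ_closed [simp]:
  "h \<in> carrier H \<Longrightarrow> k \<in> carrier H \<Longrightarrow> rb_circ H RH h k \<in> carrier H"
  by (simp add: rb_circ_def)

lemma RH_rb_circ [simp]:
  "h \<in> carrier H \<Longrightarrow> k \<in> carrier H \<Longrightarrow> RH (rb_circ H RH h k) = RH h \<otimes>\<^bsub>H\<^esub> RH k"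
  using rota_baxter_H by (simp add: rota_baxter_group_def)

lemma RH_one [simp]: "RH \<one>\<^bsub>H\<^esub> = \<one>\<^bsub>H\<^esub>"
  using RH_rb_circ[of "\<one>\<^bsub>H\<^esub>" "\<one>\<^bsub>H\<^esub>"] by (simp add: rb_circ_def)

end

locale associated_triplet = rota_baxter_groups H RH I RI
  for H :: "('h, 'm) monoid_scheme" and RH
    and I :: "('i, 'n) monoid_scheme" (structure) and RI +
  fixes \<mu> :: "'h \<Rightarrow> 'i \<Rightarrow> 'i" and \<tau> :: "'h \<times> 'h \<Rightarrow> 'i" and g :: "'h \<Rightarrow> 'i"
  assumes associated: "(\<mu>, \<tau>, g) \<in> associated_triplets H RH I RI"
begin

lemma mu_auto: "h \<in> carrier H \<Longrightarrow> \<mu> h \<in> auto I"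
  using associated by (auto simp: associated_triplets_def)

lemma mu_closed [simp]: "h \<in> carrier H \<Longrightarrow> y \<in> carrier I \<Longrightarrow> \<mu> h y \<in> carrier I"
  using mu_auto[of h] by (auto simp: auto_def hom_def)

lemma mu_mult:
  "h \<in> carrier H \<Longrightarrow> y \<in> carrier I \<Longrightarrow> z \<in> carrier I \<Longrightarrow> \<mu> h (y \<otimes> z) = \<mu> h y \<otimes> \<mu> h z"
  using mu_auto[of h] by (auto simp: auto_def hom_def)

lemma mu_surj: "h \<in> carrier H \<Longrightarrow> \<mu> h ` carrier I = carrier I"
  and mu_inj: "h \<in> carrier H \<Longrightarrow> inj_on (\<mu> h) (carrier I)"
  using mu_auto[of h] by (auto simp: auto_def Bij_def bij_betw_def)

lemma mu_one [simp]: "h \<in> carrier H \<Longrightarrow> \<mu> h \<one> = \<one>"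
  using mu_mult[of h \<one> \<one>] mu_closed[of h \<one>] by simp

lemma tau_closed [simp]: "h \<in> carrier H \<Longrightarrow> k \<in> carrier H \<Longrightarrow> \<tau> (h, k) \<in> carrier I"
  using associated by (auto simp: associated_triplets_def)

lemma g_closed [simp]: "h \<in> carrier H \<Longrightarrow> g h \<in> carrier I"
  using associated by (auto simp: associated_triplets_def)

lemma tau_one [simp]: "h \<in> carrier H \<Longrightarrow> \<tau> (\<one>\<^bsub>H\<^esub>, h) = \<one>" "h \<in> carrier H \<Longrightarrow> \<tau> (h, \<one>\<^bsub>H\<^esub>) = \<one>"
  using associated by (auto simp: associated_triplets_def)

lemma g_one [simp]: "g \<one>\<^bsub>H\<^esub> = \<one>"
  using associated by (simp add: associated_triplets_def)

lemma mu_comp: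
  assumes "h \<in> carrier H" "k \<in> carrier H" "y \<in> carrier I"
  shows "\<mu> (h \<otimes>\<^bsub>H\<^esub> k) y = \<tau> (h, k) \<otimes> \<mu> k (\<mu> h y) \<otimes> inv \<tau> (h, k)"
proof -
  have "\<mu> (h \<otimes>\<^bsub>H\<^esub> k) y = inner_auto I (\<tau> (h, k)) (\<mu> k (\<mu> h y))"
    using associated assms by (simp add: associated_triplets_def)
  then show ?thesis using assms by (simp add: inner_auto_def)
qed

lemma tau_cocycle:
  "h \<in> carrier H \<Longrightarrow> k \<in> carrier H \<Longrightarrow> l \<in> carrier H \<Longrightarrow>
    \<tau> (h, k \<otimes>\<^bsub>H\<^esub> l) \<otimes> \<tau> (k, l) = \<tau> (h \<otimes>\<^bsub>H\<^esub> k, l) \<otimes> \<mu> l (\<tau> (h, k))"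
  using associated by (simp add: associated_triplets_def)

lemma rb_condition:
  "h \<in> carrier H \<Longrightarrow> k \<in> carrier H \<Longrightarrow> y \<in> carrier I \<Longrightarrow> z \<in> carrier I \<Longrightarrow>
    triplet_rb_condition H RH I RI (\<mu>, \<tau>, g) h k y z"
  using associated by (simp add: associated_triplets_def)

text \<open>At the identity the first triplet condition makes \<open>\<mu> \<one>\<close>
  idempotent, and an injective idempotent map is the identity.\<close>

lemma mu_one_left [simp]:
  assumes "y \<in> carrier I"
  shows "\<mu> \<one>\<^bsub>H\<^esub> y = y"
proof -
  have "\<mu> \<one>\<^bsub>H\<^esub> (\<mu> \<one>\<^bsub>H\<^esub> y) = \<mu> \<one>\<^bsub>H\<^esub> y"
    using mu_comp[of "\<one>\<^bsub>H\<^esub>" "\<one>\<^bsub>H\<^esub>" y] assms by simp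
  then show ?thesis using inj_onD[OF mu_inj, of "\<one>\<^bsub>H\<^esub>" "\<mu> \<one>\<^bsub>H\<^esub> y" y] assms by simp
qed

lemma mu_inv:
  assumes "h \<in> carrier H" "y \<in> carrier I"
  shows "\<mu> h (inv y) = inv \<mu> h y"
proof (rule I.inv_equality[symmetric])
  show "\<mu> h (inv y) \<otimes> \<mu> h y = \<one>" using assms by (simp add: mu_mult[symmetric])
qed (use assms in simp_all)

abbreviation "\<E> \<equiv> triplet_group H I (\<mu>, \<tau>, g)"
abbreviation "\<R> \<equiv> triplet_operator RH I RI (\<mu>, \<tau>, g)"

lemma carrier_extension [simp]: "carrier \<E> = carrier H \<times> carrier I"
  by (simp add: triplet_group_def)

lemma one_extension [simp]: "\<one>\<^bsub>\<E>\<^esub> = (\<one>\<^bsub>H\<^esub>, \<one>)"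
  by (simp add: triplet_group_def)

lemma mult_extension [simp]:
  "(h, y) \<otimes>\<^bsub>\<E>\<^esub> (k, z) = (h \<otimes>\<^bsub>H\<^esub> k, \<tau> (h, k) \<otimes> \<mu> k y \<otimes> z)"
  by (simp add: triplet_group_def)

lemma operator_extension [simp]:
  "\<R> (h, y) = (RH h, g h \<otimes> RI (inv g h \<otimes> \<mu> (RH h) y \<otimes> g h))"
  by (simp add: triplet_operator_def)

text \<open>The first triplet condition replaces \<open>\<mu> (h2 \<otimes> h3)\<close> by a
  conjugate under \<open>\<tau> (h2, h3)\<close>; after cancellation, what is left is the second
  condition followed by a common factor.\<close>

lemma extension_assoc:
  assumes h: "h1 \<in> carrier H" "h2 \<in> carrier H" "h3 \<in> carrier H"
    and y: "y1 \<in> carrier I" "y2 \<in> carrier I" "y3 \<in> carrier I"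
  shows "(h1, y1) \<otimes>\<^bsub>\<E>\<^esub> (h2, y2) \<otimes>\<^bsub>\<E>\<^esub> (h3, y3) = (h1, y1) \<otimes>\<^bsub>\<E>\<^esub> ((h2, y2) \<otimes>\<^bsub>\<E>\<^esub> (h3, y3))"
proof -
  have c: "\<tau> (h2, h3) \<otimes> (inv \<tau> (h2, h3) \<otimes> x) = x" "inv \<tau> (h2, h3) \<otimes> (\<tau> (h2, h3) \<otimes> x) = x"
    if "x \<in> carrier I" for x
    using that h by (simp_all add: I.m_assoc[symmetric])
  have "\<tau> (h1 \<otimes>\<^bsub>H\<^esub> h2, h3) \<otimes> (\<mu> h3 (\<tau> (h1, h2)) \<otimes> x) = \<tau> (h1, h2 \<otimes>\<^bsub>H\<^esub> h3) \<otimes> (\<tau> (h2, h3) \<otimes> x)"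
    if "x \<in> carrier I" for x
    using tau_cocycle[OF h] that h by (simp add: I.m_assoc[symmetric])
  then show ?thesis using h y by (simp add: mu_mult mu_comp I.m_assoc H.m_assoc c)
qed

sublocale extension: group \<E>
proof (rule groupI)
  fix x assume "x \<in> carrier \<E>"
  then obtain h y where x: "x = (h, y)" "h \<in> carrier H" "y \<in> carrier I" by auto
  \<comment> \<open>The product of \<open>(inv h, v)\<close> and \<open>(h, y)\<close> has second
    component \<open>\<tau> (inv h, h) \<otimes> \<mu> h v \<otimes> y\<close>. Solving for
    \<open>\<mu> h v\<close> gives \<open>w\<close>, and surjectivity of \<open>\<mu> h\<close>
    gives \<open>v\<close>.\<close>
  define w where "w = inv \<tau> (inv\<^bsub>H\<^esub> h, h) \<otimes> inv y"
  have "w \<in> carrier I" using x by (simp add: w_def)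
  then obtain v where v: "v \<in> carrier I" "\<mu> h v = w" using mu_surj[OF x(2)] by (metis imageE)
  have "(inv\<^bsub>H\<^esub> h, v) \<otimes>\<^bsub>\<E>\<^esub> x = \<one>\<^bsub>\<E>\<^esub>"
    using x v by (simp add: w_def I.m_assoc[symmetric])
  then show "\<exists>y\<in>carrier \<E>. y \<otimes>\<^bsub>\<E>\<^esub> x = \<one>\<^bsub>\<E>\<^esub>" using x v by (intro bexI[of _ "(inv\<^bsub>H\<^esub> h, v)"]) simp_all
next
  fix x y z assume "x \<in> carrier \<E>" "y \<in> carrier \<E>" "z \<in> carrier \<E>"
  then show "x \<otimes>\<^bsub>\<E>\<^esub> y \<otimes>\<^bsub>\<E>\<^esub> z = x \<otimes>\<^bsub>\<E>\<^esub> (y \<otimes>\<^bsub>\<E>\<^esub> z)"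
    unfolding carrier_extension by (elim SigmaE) (simp only: extension_assoc)
qed auto

text \<open>The inverse is checked on the right, so that \<tau> appears at
  \<open>(h, inv h)\<close>, as in the last factor of \<open>w\<close> in the third triplet
  condition.\<close>

lemma inv_extension:
  assumes h: "h \<in> carrier H" and y: "y \<in> carrier I"
  shows "inv\<^bsub>\<E>\<^esub> (h, y) = (inv\<^bsub>H\<^esub> h, \<mu> (inv\<^bsub>H\<^esub> h) (inv y) \<otimes> inv \<tau> (h, inv\<^bsub>H\<^esub> h))"
proof -
  let ?v = "\<mu> (inv\<^bsub>H\<^esub> h) (inv y) \<otimes> inv \<tau> (h, inv\<^bsub>H\<^esub> h)"
  have "\<mu> (inv\<^bsub>H\<^esub> h) y \<otimes> (\<mu> (inv\<^bsub>H\<^esub> h) (inv y) \<otimes> x) = x" if "x \<in> carrier I" for x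
    using that h y by (simp add: mu_inv I.m_assoc[symmetric])
  then have "(h, y) \<otimes>\<^bsub>\<E>\<^esub> (inv\<^bsub>H\<^esub> h, ?v) = \<one>\<^bsub>\<E>\<^esub>"
    using h y by (simp add: I.m_assoc)
  then show ?thesis
    using h y by (intro extension.inv_equality[OF extension.inv_comm]) simp_all
qed

text \<open>The third triplet condition is the Rota-Baxter identity of the extension read in the
  second component; the first component is the identity of \<open>H\<close>.\<close>

lemma rota_baxter_extension: "rota_baxter_group \<E> \<R>"
proof -
  have rb: "\<R> (h1, y1) \<otimes>\<^bsub>\<E>\<^esub> \<R> (h2, y2) = \<R> (rb_circ \<E> \<R> (h1, y1) (h2, y2))"
    if h: "h1 \<in> carrier H" "h2 \<in> carrier H" and y: "y1 \<in> carrier I" "y2 \<in> carrier I" for h1 h2 y1 y2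
  proof -
    define r1 where "r1 = RH h1"
    define r2 where "r2 = RH h2"
    define s where "s = inv\<^bsub>H\<^esub> r1"
    define p where "p = RI (inv g h1 \<otimes> \<mu> r1 y1 \<otimes> g h1)"
    define q where "q = RI (inv g h2 \<otimes> \<mu> r2 y2 \<otimes> g h2)"
    \<comment> \<open>The second component of \<open>rb_circ \<E> \<R> (h1, y1) (h2, y2)\<close>, as
      computed below.\<close>
    define w where "w = \<tau> (h1 \<otimes>\<^bsub>H\<^esub> r1, h2 \<otimes>\<^bsub>H\<^esub> s)
      \<otimes> \<mu> (h2 \<otimes>\<^bsub>H\<^esub> s) (\<tau> (h1, r1) \<otimes> \<mu> r1 y1 \<otimes> g h1 \<otimes> p)
      \<otimes> \<tau> (h2, s) \<otimes> \<mu> s (y2 \<otimes> inv p \<otimes> inv g h1) \<otimes> inv \<tau> (r1, s)"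
    have c: "r1 \<in> carrier H" "r2 \<in> carrier H" "s \<in> carrier H" "p \<in> carrier I" "q \<in> carrier I"
      using h y by (simp_all add: r1_def r2_def s_def p_def q_def)
    have R1: "\<R> (h1, y1) = (r1, g h1 \<otimes> p)" and R2: "\<R> (h2, y2) = (r2, g h2 \<otimes> q)"
      by (simp_all add: r1_def r2_def p_def q_def)
    have "rb_circ \<E> \<R> (h1, y1) (h2, y2)
        = ((h1, y1) \<otimes>\<^bsub>\<E>\<^esub> (r1, g h1 \<otimes> p)) \<otimes>\<^bsub>\<E>\<^esub> ((h2, y2) \<otimes>\<^bsub>\<E>\<^esub> inv\<^bsub>\<E>\<^esub> (r1, g h1 \<otimes> p))"
      using extension.rb_circ_regroup[of "(h1, y1)" \<R> "(h2, y2)"] h y c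
      by (simp add: R1 del: operator_extension mult_extension)
    also have "\<dots> = (rb_circ H RH h1 h2, w)"
      using h y c H.rb_circ_regroup[of h1 RH h2]
      by (simp only: inv_extension mult_extension I.m_closed g_closed s_def[symmetric] r1_def[symmetric])
        (simp add: w_def I.m_assoc I.inv_mult_group mu_mult)
    finally have "\<R> (rb_circ \<E> \<R> (h1, y1) (h2, y2)) = \<R> (rb_circ H RH h1 h2, w)" by simp
    also have "\<dots> = (r1 \<otimes>\<^bsub>H\<^esub> r2, \<tau> (r1, r2) \<otimes> \<mu> r2 (g h1 \<otimes> p) \<otimes> g h2 \<otimes> q)"
      using rb_condition[OF h y] h
      by (simp add: triplet_rb_condition_def Let_def r1_def r2_def s_def p_def q_def w_def)
    finally show ?thesis using h y c by (simp add: R1 R2 I.m_assoc del: operator_extension)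
  qed
  show ?thesis
    unfolding rota_baxter_group_def
  proof (intro conjI ballI)
    fix x y assume "x \<in> carrier \<E>" "y \<in> carrier \<E>"
    then show "\<R> x \<otimes>\<^bsub>\<E>\<^esub> \<R> y = \<R> (rb_circ \<E> \<R> x y)"
      unfolding carrier_extension by (elim SigmaE) (simp only: rb)
  qed (auto intro: extension.is_group)
qed

lemma rb_extension_triplet: "rb_extension H RH I RI \<E> \<R> (\<lambda>y. (\<one>\<^bsub>H\<^esub>, y)) fst"
  unfolding rb_extension_def
proof (intro conjI)
  show "(\<lambda>y. (\<one>\<^bsub>H\<^esub>, y)) \<in> rb_hom I RI \<E> \<R>"
    by (simp add: rb_hom_def hom_def)
  show "fst \<in> rb_hom \<E> \<R> H RH"
    by (auto simp: rb_hom_def hom_def)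
  show "(\<lambda>y. (\<one>\<^bsub>H\<^esub>, y)) ` carrier I = kernel \<E> H fst"
    by (auto simp: kernel_def)
  show "fst ` carrier \<E> = carrier H"
    using I.one_closed by (simp add: fst_image_times) blast
qed (simp_all add: rota_baxter_extension inj_on_def)

end

section \<open>Equivalences of triplet extensions as maps from H to I\<close>

context rota_baxter_groups
begin

text \<open>The conditions for \<open>(h, y) \<mapsto> (h, \<theta> h \<otimes> y)\<close> to be an equivalence of triplet extensions.\<close>

definition gauge ::
  "('h, 'i) triplet \<Rightarrow> ('h, 'i) triplet \<Rightarrow> ('h \<Rightarrow> 'i) \<Rightarrow> bool" where
  "gauge = (\<lambda>(\<mu>, \<tau>, g) (\<mu>', \<tau>', g') \<theta>.
     \<theta> \<in> carrier H \<rightarrow> carrier I \<and>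
     (\<forall>h\<in>carrier H. \<forall>k\<in>carrier H. \<forall>y\<in>carrier I.
        \<theta> (h \<otimes>\<^bsub>H\<^esub> k) \<otimes> (\<tau> (h, k) \<otimes> \<mu> k y) = \<tau>' (h, k) \<otimes> \<mu>' k (\<theta> h \<otimes> y) \<otimes> \<theta> k) \<and>
     (\<forall>h\<in>carrier H. \<forall>y\<in>carrier I.
        \<theta> (RH h) \<otimes> (g h \<otimes> RI (inv g h \<otimes> \<mu> (RH h) y \<otimes> g h))
        = g' h \<otimes> RI (inv g' h \<otimes> \<mu>' (RH h) (\<theta> h \<otimes> y) \<otimes> g' h)))"

lemma gaugeD:
  assumes "gauge (\<mu>, \<tau>, g) (\<mu>', \<tau>', g') \<theta>"
  shows "h \<in> carrier H \<Longrightarrow> \<theta> h \<in> carrier I"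
    and "h \<in> carrier H \<Longrightarrow> k \<in> carrier H \<Longrightarrow> y \<in> carrier I \<Longrightarrow>
      \<theta> (h \<otimes>\<^bsub>H\<^esub> k) \<otimes> (\<tau> (h, k) \<otimes> \<mu> k y) = \<tau>' (h, k) \<otimes> \<mu>' k (\<theta> h \<otimes> y) \<otimes> \<theta> k"
    and "h \<in> carrier H \<Longrightarrow> y \<in> carrier I \<Longrightarrow>
      \<theta> (RH h) \<otimes> (g h \<otimes> RI (inv g h \<otimes> \<mu> (RH h) y \<otimes> g h))
      = g' h \<otimes> RI (inv g' h \<otimes> \<mu>' (RH h) (\<theta> h \<otimes> y) \<otimes> g' h)"
  using assms unfolding gauge_def by auto

text \<open>Since \<open>(h, y)\<close> is the product of \<open>(h, \<one>)\<close> and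
  \<open>(\<one>, y)\<close>, and an equivalence fixes the second factor, it is determined by the
  I-components \<open>\<theta> h\<close> of the images of \<open>(h, \<one>)\<close>.\<close>

lemma triplet_equiv_iff_gauge:
  assumes t: "(\<mu>, \<tau>, g) \<in> associated_triplets H RH I RI"
    and t': "(\<mu>', \<tau>', g') \<in> associated_triplets H RH I RI"
  shows "triplet_equiv H RH I RI (\<mu>, \<tau>, g) (\<mu>', \<tau>', g') \<longleftrightarrow> (\<exists>\<theta>. gauge (\<mu>, \<tau>, g) (\<mu>', \<tau>', g') \<theta>)"
proof -
  interpret T: associated_triplet H RH I RI \<mu> \<tau> g by unfold_locales (rule t)
  interpret T': associated_triplet H RH I RI \<mu>' \<tau>' g' by unfold_locales (rule t')
  show ?thesis
  proof
    assume "triplet_equiv H RH I RI (\<mu>, \<tau>, g) (\<mu>', \<tau>', g')"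
    then obtain F where F: "F \<in> rb_hom T.\<E> T.\<R> T'.\<E> T'.\<R>"
      and Fi: "\<And>y. y \<in> carrier I \<Longrightarrow> F (\<one>\<^bsub>H\<^esub>, y) = (\<one>\<^bsub>H\<^esub>, y)"
      and Fp: "\<And>e. e \<in> carrier T.\<E> \<Longrightarrow> fst (F e) = fst e"
      unfolding triplet_equiv_def rb_extension_equiv_def by blast
    define \<theta> where "\<theta> h = snd (F (h, \<one>))" for h
    have F1: "F (h, \<one>) = (h, \<theta> h)" if "h \<in> carrier H" for h
      using Fp[of "(h, \<one>)"] that by (simp add: \<theta>_def prod_eq_iff)
    have Fh: "F \<in> hom T.\<E> T'.\<E>" using F unfolding rb_hom_def by blast
    have FR: "F (T.\<R> x) = T'.\<R> (F x)" if "x \<in> carrier T.\<E>" for x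
      using F that unfolding rb_hom_def by blast
    note Fm = hom_mult[OF Fh]
    have th: "\<theta> h \<in> carrier I" if "h \<in> carrier H" for h
    proof -
      have "F (h, \<one>) \<in> carrier T'.\<E>" using hom_in_carrier[OF Fh] that by auto
      then show ?thesis by (simp add: F1 that)
    qed
    have Fe: "F (h, y) = (h, \<theta> h \<otimes> y)" if "h \<in> carrier H" "y \<in> carrier I" for h y
      using Fm[of "(h, \<one>)" "(\<one>\<^bsub>H\<^esub>, y)"] that by (simp add: F1 Fi th)
    \<comment> \<open>Taking \<open>\<one>\<close> as second coordinate of the right-hand factor
      loses nothing: a general one only multiplies both sides from the right.\<close>
    have "\<theta> (h \<otimes>\<^bsub>H\<^esub> k) \<otimes> (\<tau> (h, k) \<otimes> \<mu> k y) = \<tau>' (h, k) \<otimes> \<mu>' k (\<theta> h \<otimes> y) \<otimes> \<theta> k"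
      if "h \<in> carrier H" "k \<in> carrier H" "y \<in> carrier I" for h k y
      using Fm[of "(h, y)" "(k, \<one>)"] that by (simp add: Fe th)
    moreover have "\<theta> (RH h) \<otimes> (g h \<otimes> RI (inv g h \<otimes> \<mu> (RH h) y \<otimes> g h))
        = g' h \<otimes> RI (inv g' h \<otimes> \<mu>' (RH h) (\<theta> h \<otimes> y) \<otimes> g' h)"
      if "h \<in> carrier H" "y \<in> carrier I" for h y
      using FR[of "(h, y)"] that by (simp add: Fe)
    ultimately have "gauge (\<mu>, \<tau>, g) (\<mu>', \<tau>', g') \<theta>" by (simp add: gauge_def th)
    then show "\<exists>\<theta>. gauge (\<mu>, \<tau>, g) (\<mu>', \<tau>', g') \<theta>" by blast
  next
    assume "\<exists>\<theta>. gauge (\<mu>, \<tau>, g) (\<mu>', \<tau>', g') \<theta>"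
    then obtain \<theta> where th: "gauge (\<mu>, \<tau>, g) (\<mu>', \<tau>', g') \<theta>" ..
    note hom = gaugeD(2)[OF th] and rb = gaugeD(3)[OF th] and th = gaugeD(1)[OF th]
    \<comment> \<open>At the identity the first gauge equation reads
      \<open>\<theta> \<one> = \<theta> \<one> \<otimes> \<theta> \<one>\<close>. That
      \<open>\<theta> \<one>\<close> is trivial makes the map \<open>F\<close> below the identity on
      \<open>I\<close>.\<close>
    have th1: "\<theta> \<one>\<^bsub>H\<^esub> = \<one>"
      using hom[of "\<one>\<^bsub>H\<^esub>" "\<one>\<^bsub>H\<^esub>" \<one>] th[of "\<one>\<^bsub>H\<^esub>"] by simp
    define F where "F = (\<lambda>(h, y). (h, \<theta> h \<otimes> y))"
    have "bij_betw F (carrier H \<times> carrier I) (carrier H \<times> carrier I)"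
      by (rule bij_betwI[where g = "\<lambda>(h, y). (h, inv \<theta> h \<otimes> y)"])
        (auto simp: F_def th I.m_assoc[symmetric])
    moreover have "F (x \<otimes>\<^bsub>T.\<E>\<^esub> y) = F x \<otimes>\<^bsub>T'.\<E>\<^esub> F y" if xy: "x \<in> carrier T.\<E>" "y \<in> carrier T.\<E>" for x y
    proof -
      obtain h u k v where x: "x = (h, u)" "h \<in> carrier H" "u \<in> carrier I"
        and y: "y = (k, v)" "k \<in> carrier H" "v \<in> carrier I"
        using xy by auto
      have "\<theta> (h \<otimes>\<^bsub>H\<^esub> k) \<otimes> (\<tau> (h, k) \<otimes> \<mu> k u \<otimes> v)
          = \<theta> (h \<otimes>\<^bsub>H\<^esub> k) \<otimes> (\<tau> (h, k) \<otimes> \<mu> k u) \<otimes> v"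
        using x y by (simp add: I.m_assoc th)
      also have "\<dots> = \<tau>' (h, k) \<otimes> \<mu>' k (\<theta> h \<otimes> u) \<otimes> (\<theta> k \<otimes> v)"
        using x y by (simp only: hom) (simp add: I.m_assoc th)
      finally show ?thesis by (simp add: F_def x y)
    qed
    ultimately have iso: "F \<in> iso T.\<E> T'.\<E>"
      by (auto simp: iso_def hom_def F_def th)
    moreover have "F (T.\<R> x) = T'.\<R> (F x)" if "x \<in> carrier T.\<E>" for x
      using that rb by (auto simp: F_def)
    ultimately have "F \<in> rb_hom T.\<E> T.\<R> T'.\<E> T'.\<R>"
      unfolding rb_hom_def iso_def by blast
    then show "triplet_equiv H RH I RI (\<mu>, \<tau>, g) (\<mu>', \<tau>', g')"
      unfolding triplet_equiv_def rb_extension_equiv_def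
      using iso T.rb_extension_triplet T'.rb_extension_triplet
      by (intro conjI exI[of _ F]) (simp_all add: F_def th1 split_beta)
  qed
qed

text \<open>Reflexivity carries the content: \<open>triplet_equiv\<close> includes the demand that
  both sides are Rota-Baxter extensions.\<close>

lemma equiv_triplet_equiv:
  "equiv (coupled_triplets H RH I RI \<alpha>)
     {(t, t'). t \<in> coupled_triplets H RH I RI \<alpha> \<and> t' \<in> coupled_triplets H RH I RI \<alpha> \<and>
       triplet_equiv H RH I RI t t'}"
proof -
  have "triplet_equiv H RH I RI t t" if t: "t \<in> coupled_triplets H RH I RI \<alpha>" for t
  proof -
    obtain \<mu> \<tau> g where t': "t = (\<mu>, \<tau>, g)" "(\<mu>, \<tau>, g) \<in> associated_triplets H RH I RI"
      using t by (auto simp: coupled_triplets_def)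
    interpret T: associated_triplet H RH I RI \<mu> \<tau> g by unfold_locales (rule t')
    show ?thesis unfolding triplet_equiv_def t'
      by (rule rb_extension_equiv_refl[OF T.rb_extension_triplet])
  qed
  then show ?thesis
    unfolding triplet_equiv_def
    by (intro equivI refl_onI symI transI)
      (auto intro: rb_extension_equiv_sym rb_extension_equiv_trans)
qed

end

section \<open>Cocycles and coboundaries\<close>

locale rota_baxter_coupling = rota_baxter_groups H RH I RI
  for H :: "('h, 'm) monoid_scheme" and RH
    and I :: "('i, 'n) monoid_scheme" (structure) and RI +
  fixes \<alpha> :: "'h \<Rightarrow> ('i \<Rightarrow> 'i) set"
  assumes RI_center_subset: "RI ` center I \<subseteq> center I" and coupling: "coupling H I \<alpha>"
begin

declare I.center_closed [simp] I.center_mult [simp] I.center_inv [simp]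

lemma RI_center [simp]: "z \<in> center I \<Longrightarrow> RI z \<in> center I"
  using RI_center_subset by blast

lemma RI_mult: "x \<in> center I \<Longrightarrow> y \<in> carrier I \<Longrightarrow> RI (x \<otimes> y) = RI x \<otimes> RI y"
  by (rule rb_operator_central_mult[OF rota_baxter_I RI_center_subset])

lemma RI_one [simp]: "RI \<one> = \<one>"
  using RI_mult[of \<one> \<one>] by simp

lemma RI_inv: "z \<in> center I \<Longrightarrow> RI (inv z) = inv RI z"
  using RI_mult[of "inv z" z] by (intro I.inv_equality[symmetric]) simp_all

lemma RI_central_mult:
  assumes "x \<in> carrier I" "z \<in> center I"
  shows "RI (I.central_mult x z) = I.central_mult (RI x) (RI z)"
  using assms RI_mult[of z x] I.center_commute[of z x] I.center_commute[of "RI z" "RI x"]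
  by (simp add: I.central_mult_def)

abbreviation "act \<equiv> coupling_action \<alpha>"
abbreviation "A \<equiv> center_group I"

text \<open>For each single \<open>h\<close> the coset \<open>\<alpha> h\<close> supplies an
  automorphism, which is enough for \<open>act h\<close> to be an endomorphism of the centre. How
  \<open>act\<close> depends on \<open>h\<close> is settled later with the help of a
  triplet.\<close>

lemma act_auto:
  assumes "h \<in> carrier H"
  shows "\<exists>f\<in>auto I. \<forall>z\<in>center I. act h z = f z"
  using I.coupling_representative[OF coupling assms] I.coupling_action_eq by metis

lemma act_center [simp]: "h \<in> carrier H \<Longrightarrow> z \<in> center I \<Longrightarrow> act h z \<in> center I"
  using act_auto[of h] I.auto_center by metis

lemma act_mult:
  assumes "h \<in> carrier H" "y \<in> center I" "z \<in> center I"
  shows "act h (y \<otimes> z) = act h y \<otimes> act h z"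
proof -
  obtain f where f: "f \<in> auto I" "\<And>z. z \<in> center I \<Longrightarrow> act h z = f z"
    using act_auto[OF assms(1)] by blast
  have "f \<in> hom I I" using f(1) by (simp add: auto_def)
  from hom_mult[OF this] show ?thesis using assms by (simp add: f(2))
qed

lemma act_one [simp]: "h \<in> carrier H \<Longrightarrow> act h \<one> = \<one>"
  using act_mult[of h \<one> \<one>] act_center[of h \<one>, THEN I.center_closed] by simp

lemma act_inv: "h \<in> carrier H \<Longrightarrow> z \<in> center I \<Longrightarrow> act h (inv z) = inv act h z"
  using act_mult[of h "inv z" z] by (intro I.inv_equality[symmetric]) simp_all

lemmas central_simps = RI_mult RI_inv act_mult act_inv I.center_inv_mult I.center_ac

lemma C1_center: "k \<in> C1 H A \<Longrightarrow> h \<in> carrier H \<Longrightarrow> k h \<in> center I"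
  by (auto simp: C1_def)

lemma C2_center: "f \<in> C2 H A \<Longrightarrow> h \<in> carrier H \<Longrightarrow> l \<in> carrier H \<Longrightarrow> f (h, l) \<in> center I"
  by (auto simp: C2_def)

text \<open>The argument of \<open>RI\<close> in \<open>Phi2\<close> before \<open>act\<close> is
  applied to it. It is also the factor that a change of \<tau> by \<open>f\<close> contributes to
  \<open>w\<close> in the third triplet condition.\<close>

definition cochain_defect :: "('h \<times> 'h \<Rightarrow> 'i) \<Rightarrow> 'h \<Rightarrow> 'h \<Rightarrow> 'i" where
  "cochain_defect f h l =
     f (h \<otimes>\<^bsub>H\<^esub> RH h, l \<otimes>\<^bsub>H\<^esub> inv\<^bsub>H\<^esub> RH h) \<otimes> act (l \<otimes>\<^bsub>H\<^esub> inv\<^bsub>H\<^esub> RH h) (f (h, RH h))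
     \<otimes> f (l, inv\<^bsub>H\<^esub> RH h) \<otimes> inv f (RH h, inv\<^bsub>H\<^esub> RH h)"

lemma cochain_defect_center [simp]:
  "f \<in> C2 H A \<Longrightarrow> h \<in> carrier H \<Longrightarrow> l \<in> carrier H \<Longrightarrow> cochain_defect f h l \<in> center I"
  by (simp add: cochain_defect_def C2_center)

text \<open>The cocycle conditions with both sides moved so that each side is multiplicative in \<open>(f, k)\<close>.\<close>

definition cocycle_eqs :: "('h \<times> 'h \<Rightarrow> 'i) \<Rightarrow> ('h \<Rightarrow> 'i) \<Rightarrow> bool" where
  "cocycle_eqs f k \<longleftrightarrow>
     (\<forall>h1\<in>carrier H. \<forall>h2\<in>carrier H. \<forall>h3\<in>carrier H.
        f (h1, h2 \<otimes>\<^bsub>H\<^esub> h3) \<otimes> f (h2, h3) = f (h1 \<otimes>\<^bsub>H\<^esub> h2, h3) \<otimes> act h3 (f (h1, h2))) \<and>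
     (\<forall>h1\<in>carrier H. \<forall>h2\<in>carrier H.
        k h2 \<otimes> act (RH h2) (k h1) \<otimes> RI (act (RH h1 \<otimes>\<^bsub>H\<^esub> RH h2) (cochain_defect f h1 h2))
        = f (RH h1, RH h2) \<otimes> k (rb_circ H RH h1 h2)
          \<otimes> RI (act (RH h2) (act h2 (k h1) \<otimes> inv k h1)))"

lemma cocycle_eqsD:
  assumes "cocycle_eqs f k"
  shows "h1 \<in> carrier H \<Longrightarrow> h2 \<in> carrier H \<Longrightarrow> h3 \<in> carrier H \<Longrightarrow>
      f (h1, h2 \<otimes>\<^bsub>H\<^esub> h3) \<otimes> f (h2, h3) = f (h1 \<otimes>\<^bsub>H\<^esub> h2, h3) \<otimes> act h3 (f (h1, h2))"
    and "h1 \<in> carrier H \<Longrightarrow> h2 \<in> carrier H \<Longrightarrow>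
      k h2 \<otimes> act (RH h2) (k h1) \<otimes> RI (act (RH h1 \<otimes>\<^bsub>H\<^esub> RH h2) (cochain_defect f h1 h2))
      = f (RH h1, RH h2) \<otimes> k (rb_circ H RH h1 h2)
        \<otimes> RI (act (RH h2) (act h2 (k h1) \<otimes> inv k h1))"
  using assms by (simp_all add: cocycle_eqs_def)

lemma center_eq_one_iff:
  "x \<in> center I \<Longrightarrow> y \<in> center I \<Longrightarrow> x \<otimes> inv y = \<one> \<longleftrightarrow> x = y"
  by (metis I.center_closed I.inv_closed I.inv_equality I.inv_inv I.r_inv)

text \<open>Inverses in \<open>A\<close> and in \<open>I\<close> agree on central elements, so the
  passage to equations in \<open>I\<close> is made once \<open>f\<close> and \<open>k\<close> are
  known to be cochains; if they are not, both sides fail.\<close>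

lemma Z2_RBE_iff:
  "(f, k) \<in> Z2_RBE H RH A RI act \<longleftrightarrow> f \<in> C2 H A \<and> k \<in> C1 H A \<and> cocycle_eqs f k"
proof (cases "f \<in> C2 H A \<and> k \<in> C1 H A")
  case True
  note c [simp] = C2_center[OF True[THEN conjunct1]] C1_center[OF True[THEN conjunct2]]
  have 1: "f (h1, h2 \<otimes>\<^bsub>H\<^esub> h3) \<otimes>\<^bsub>A\<^esub> f (h2, h3) \<otimes>\<^bsub>A\<^esub> inv\<^bsub>A\<^esub> (f (h1 \<otimes>\<^bsub>H\<^esub> h2, h3))
        \<otimes>\<^bsub>A\<^esub> inv\<^bsub>A\<^esub> (act h3 (f (h1, h2))) = \<one>\<^bsub>A\<^esub> \<longleftrightarrow>
      f (h1, h2 \<otimes>\<^bsub>H\<^esub> h3) \<otimes> f (h2, h3) = f (h1 \<otimes>\<^bsub>H\<^esub> h2, h3) \<otimes> act h3 (f (h1, h2))"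
    if [simp]: "h1 \<in> carrier H" "h2 \<in> carrier H" "h3 \<in> carrier H" for h1 h2 h3
    by (subst center_eq_one_iff[symmetric]) (simp_all add: I.inv_center_group I.center_inv_mult I.m_assoc)
  have 2: "partial1 H RH A act k (h1, h2)
        \<otimes>\<^bsub>A\<^esub> inv\<^bsub>A\<^esub> (RI (act (RH h2) (act h2 (k h1) \<otimes>\<^bsub>A\<^esub> inv\<^bsub>A\<^esub> (k h1))))
        \<otimes>\<^bsub>A\<^esub> inv\<^bsub>A\<^esub> (Phi2 H RH A RI act f (h1, h2)) = \<one>\<^bsub>A\<^esub> \<longleftrightarrow>
      k h2 \<otimes> act (RH h2) (k h1) \<otimes> RI (act (RH h1 \<otimes>\<^bsub>H\<^esub> RH h2) (cochain_defect f h1 h2))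
        = f (RH h1, RH h2) \<otimes> k (rb_circ H RH h1 h2)
          \<otimes> RI (act (RH h2) (act h2 (k h1) \<otimes> inv k h1))"
    if [simp]: "h1 \<in> carrier H" "h2 \<in> carrier H" for h1 h2
  proof -
    define D where "D = RI (act (RH h1 \<otimes>\<^bsub>H\<^esub> RH h2) (cochain_defect f h1 h2))"
    define Y where "Y = RI (act (RH h2) (act h2 (k h1) \<otimes> inv k h1))"
    have [simp]: "D \<in> center I" "Y \<in> center I" using True by (simp_all add: D_def Y_def)
    have P: "Phi2 H RH A RI act f (h1, h2) = f (RH h1, RH h2) \<otimes> inv D"
      by (simp add: Phi2_def D_def I.inv_center_group cochain_defect_def)
    have Q: "inv\<^bsub>A\<^esub> (RI (act (RH h2) (act h2 (k h1) \<otimes>\<^bsub>A\<^esub> inv\<^bsub>A\<^esub> (k h1)))) = inv Y"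
      by (simp add: Y_def I.inv_center_group)
    show ?thesis
      unfolding P Q D_def[symmetric] Y_def[symmetric]
      by (subst center_eq_one_iff[symmetric])
        (simp_all add: partial1_def I.inv_center_group I.center_inv_mult I.center_ac)
  qed
  show ?thesis using True by (simp add: Z2_RBE_def cocycle_eqs_def 1 2 del: I.center_group_simps cong: ball_cong)
qed (auto simp: Z2_RBE_def)

section \<open>Groups of cochains, cocycles and coboundaries\<close>

abbreviation "cochain_group \<equiv>
  product_group (carrier H \<times> carrier H) (\<lambda>_. A) \<times>\<times> product_group (carrier H) (\<lambda>_. A)"

abbreviation "cocycle_group \<equiv>
  (C2_group H A \<times>\<times> C1_group H A)\<lparr>carrier := Z2_RBE H RH A RI act\<rparr>"

lemma group_A: "group A"
  using I.comm_group_center_group by (rule comm_group.axioms)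

lemma group_cochain_group: "group cochain_group"
  by (intro DirProd_group product_group group_A)

lemma inv_cochain_group:
  assumes f: "f \<in> carrier H \<times> carrier H \<rightarrow>\<^sub>E center I" and k: "k \<in> carrier H \<rightarrow>\<^sub>E center I"
  shows "inv\<^bsub>cochain_group\<^esub> (f, k) = (\<lambda>x\<in>carrier H \<times> carrier H. inv f x, \<lambda>h\<in>carrier H. inv k h)"
proof -
  have "inv\<^bsub>cochain_group\<^esub> (f, k)
      = (\<lambda>x\<in>carrier H \<times> carrier H. inv\<^bsub>A\<^esub> f x, \<lambda>h\<in>carrier H. inv\<^bsub>A\<^esub> k h)"
    using f k by (simp add: inv_DirProd product_group group_A)
  also have "\<dots> = (\<lambda>x\<in>carrier H \<times> carrier H. inv f x, \<lambda>h\<in>carrier H. inv k h)"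
    using PiE_mem[OF f] PiE_mem[OF k] by (auto simp: I.inv_center_group intro!: restrict_ext)
  finally show ?thesis .
qed

lemma cocycle_group_eq: "cocycle_group = cochain_group\<lparr>carrier := Z2_RBE H RH A RI act\<rparr>"
  by (simp add: DirProd_def C1_group_def C2_group_def)

text \<open>Both sides of the equations in \<open>cocycle_eqs\<close> are multiplicative in
  \<open>(f, k)\<close>, as \<open>act h\<close> and \<open>RI\<close> are homomorphisms on the
  commutative centre. So two such equations can be multiplied, and one can be inverted.\<close>

lemma subgroup_Z2_RBE: "subgroup (Z2_RBE H RH A RI act) cochain_group"
proof (rule subgroup.intro)
  show "Z2_RBE H RH A RI act \<subseteq> carrier cochain_group"
    by (auto simp: Z2_RBE_def C1_def C2_def)
next
  fix x y assume "x \<in> Z2_RBE H RH A RI act" "y \<in> Z2_RBE H RH A RI act"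
  then obtain f k f' k' where xy: "x = (f, k)" "y = (f', k')"
    and f: "f \<in> C2 H A" "f' \<in> C2 H A" and k: "k \<in> C1 H A" "k' \<in> C1 H A"
    and e: "cocycle_eqs f k" "cocycle_eqs f' k'"
    by (cases x; cases y) (simp add: Z2_RBE_iff)
  note c [simp] = C2_center[OF f(1)] C2_center[OF f(2)] C1_center[OF k(1)] C1_center[OF k(2)]
  let ?f = "\<lambda>x\<in>carrier H \<times> carrier H. f x \<otimes> f' x" and ?k = "\<lambda>h\<in>carrier H. k h \<otimes> k' h"
  have "?f \<in> C2 H A" "?k \<in> C1 H A" using f k by (auto simp: C1_def C2_def)
  moreover have defect: "cochain_defect ?f h l = cochain_defect f h l \<otimes> cochain_defect f' h l"
    if "h \<in> carrier H" "l \<in> carrier H" for h l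
    using that by (simp add: cochain_defect_def central_simps)
  moreover have "cocycle_eqs ?f ?k"
    unfolding cocycle_eqs_def
  proof (intro conjI ballI)
    fix h1 h2 h3 assume "h1 \<in> carrier H" "h2 \<in> carrier H" "h3 \<in> carrier H"
    then show "?f (h1, h2 \<otimes>\<^bsub>H\<^esub> h3) \<otimes> ?f (h2, h3) = ?f (h1 \<otimes>\<^bsub>H\<^esub> h2, h3) \<otimes> act h3 (?f (h1, h2))"
      using arg_cong2[OF cocycle_eqsD(1)[OF e(1)] cocycle_eqsD(1)[OF e(2)], of h1 h2 h3 h1 h2 h3 "(\<otimes>)"]
      by (simp add: central_simps)
  next
    fix h1 h2 assume "h1 \<in> carrier H" "h2 \<in> carrier H"
    then show "?k h2 \<otimes> act (RH h2) (?k h1)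
          \<otimes> RI (act (RH h1 \<otimes>\<^bsub>H\<^esub> RH h2) (cochain_defect ?f h1 h2))
        = ?f (RH h1, RH h2) \<otimes> ?k (rb_circ H RH h1 h2)
          \<otimes> RI (act (RH h2) (act h2 (?k h1) \<otimes> inv ?k h1))"
      using arg_cong2[OF cocycle_eqsD(2)[OF e(1)] cocycle_eqsD(2)[OF e(2)], of h1 h2 h1 h2 "(\<otimes>)"] f
      by (simp add: central_simps defect)
  qed
  ultimately have "(?f, ?k) \<in> Z2_RBE H RH A RI act" by (simp add: Z2_RBE_iff)
  then show "x \<otimes>\<^bsub>cochain_group\<^esub> y \<in> Z2_RBE H RH A RI act" by (simp add: xy)
next
  have "cochain_defect (\<lambda>x\<in>carrier H \<times> carrier H. \<one>) h l = \<one>"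
    if "h \<in> carrier H" "l \<in> carrier H" for h l
    using that by (simp add: cochain_defect_def)
  then show "\<one>\<^bsub>cochain_group\<^esub> \<in> Z2_RBE H RH A RI act"
    by (auto simp: Z2_RBE_iff cocycle_eqs_def C1_def C2_def)
next
  fix x assume "x \<in> Z2_RBE H RH A RI act"
  then obtain f k where x: "x = (f, k)" and f: "f \<in> C2 H A" and k: "k \<in> C1 H A"
    and e: "cocycle_eqs f k"
    by (cases x) (simp add: Z2_RBE_iff)
  note c [simp] = C2_center[OF f] C1_center[OF k]
  let ?f = "\<lambda>x\<in>carrier H \<times> carrier H. inv f x" and ?k = "\<lambda>h\<in>carrier H. inv k h"
  have "?f \<in> C2 H A" "?k \<in> C1 H A" using f k by (auto simp: C1_def C2_def)
  moreover have defect: "cochain_defect ?f h l = inv cochain_defect f h l"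
    if "h \<in> carrier H" "l \<in> carrier H" for h l
    using that by (simp add: cochain_defect_def central_simps)
  moreover have "cocycle_eqs ?f ?k"
    unfolding cocycle_eqs_def
  proof (intro conjI ballI)
    fix h1 h2 h3 assume "h1 \<in> carrier H" "h2 \<in> carrier H" "h3 \<in> carrier H"
    then show "?f (h1, h2 \<otimes>\<^bsub>H\<^esub> h3) \<otimes> ?f (h2, h3) = ?f (h1 \<otimes>\<^bsub>H\<^esub> h2, h3) \<otimes> act h3 (?f (h1, h2))"
      using arg_cong[OF cocycle_eqsD(1)[OF e], of h1 h2 h3 "m_inv I"] by (simp add: central_simps)
  next
    fix h1 h2 assume "h1 \<in> carrier H" "h2 \<in> carrier H"
    then show "?k h2 \<otimes> act (RH h2) (?k h1)
          \<otimes> RI (act (RH h1 \<otimes>\<^bsub>H\<^esub> RH h2) (cochain_defect ?f h1 h2))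
        = ?f (RH h1, RH h2) \<otimes> ?k (rb_circ H RH h1 h2)
          \<otimes> RI (act (RH h2) (act h2 (?k h1) \<otimes> inv ?k h1))"
      using arg_cong[OF cocycle_eqsD(2)[OF e], of h1 h2 "m_inv I"] f
      by (simp add: central_simps defect)
  qed
  ultimately have "(?f, ?k) \<in> Z2_RBE H RH A RI act" by (simp add: Z2_RBE_iff)
  then show "inv\<^bsub>cochain_group\<^esub> x \<in> Z2_RBE H RH A RI act"
    using f k by (simp add: x inv_cochain_group C1_def C2_def)
qed

definition coboundary :: "('h \<Rightarrow> 'i) \<Rightarrow> ('h \<times> 'h \<Rightarrow> 'i) \<times> ('h \<Rightarrow> 'i)" where
  "coboundary \<theta> =
     (\<lambda>(h, l)\<in>carrier H \<times> carrier H. \<theta> l \<otimes> inv \<theta> (h \<otimes>\<^bsub>H\<^esub> l) \<otimes> act l (\<theta> h),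
      \<lambda>h\<in>carrier H. \<theta> (RH h) \<otimes> inv RI (act (RH h) (\<theta> h)))"

lemma B2_RBE_eq: "B2_RBE H RH A RI act = coboundary ` C1 H A"
proof -
  have "(delta1 H A act \<theta>, \<lambda>h\<in>carrier H. inv\<^bsub>A\<^esub> (Phi1 H RH A RI act \<theta> h)) = coboundary \<theta>"
    if "\<theta> \<in> C1 H A" for \<theta>
    using C1_center[OF that]
    by (auto simp: coboundary_def delta1_def Phi1_def I.inv_center_group I.center_inv_mult
        I.center_ac(2) intro!: restrict_ext)
  then show ?thesis unfolding B2_RBE_def Setcompr_eq_image by (intro image_cong refl)
qed

lemma coboundary_closed:
  assumes "\<theta> \<in> C1 H A"
  shows "fst (coboundary \<theta>) \<in> carrier H \<times> carrier H \<rightarrow>\<^sub>E center I"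
    and "snd (coboundary \<theta>) \<in> carrier H \<rightarrow>\<^sub>E center I"
  using C1_center[OF assms] by (auto simp: coboundary_def)

text \<open>An image under the multiplicative map \<open>coboundary\<close>. The ambient group is
  that of all extensional functions, because the cocycle equations are known for coboundaries only
  when a triplet exists.\<close>

lemma subgroup_B2_RBE: "subgroup (B2_RBE H RH A RI act) cochain_group"
  unfolding B2_RBE_eq
proof (rule subgroup.intro)
  show "coboundary ` C1 H A \<subseteq> carrier cochain_group"
    using coboundary_closed by (intro image_subsetI) (simp add: mem_Times_iff)
next
  fix x y assume "x \<in> coboundary ` C1 H A" "y \<in> coboundary ` C1 H A"
  then obtain \<theta> \<theta>' where x: "x = coboundary \<theta>" "\<theta> \<in> C1 H A" and y: "y = coboundary \<theta>'" "\<theta>' \<in> C1 H A"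
    by blast
  note c [simp] = C1_center[OF x(2)] C1_center[OF y(2)]
  have "x \<otimes>\<^bsub>cochain_group\<^esub> y = coboundary (\<lambda>h\<in>carrier H. \<theta> h \<otimes> \<theta>' h)"
    unfolding x y coboundary_def by (auto simp: central_simps intro!: restrict_ext)
  moreover have "(\<lambda>h\<in>carrier H. \<theta> h \<otimes> \<theta>' h) \<in> C1 H A" using x y by (auto simp: C1_def)
  ultimately show "x \<otimes>\<^bsub>cochain_group\<^esub> y \<in> coboundary ` C1 H A" by blast
next
  have "\<one>\<^bsub>cochain_group\<^esub> = coboundary (\<lambda>h\<in>carrier H. \<one>)"
    unfolding coboundary_def by (auto intro!: restrict_ext)
  moreover have "(\<lambda>h\<in>carrier H. \<one>) \<in> C1 H A" by (auto simp: C1_def)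
  ultimately show "\<one>\<^bsub>cochain_group\<^esub> \<in> coboundary ` C1 H A" by blast
next
  fix x assume "x \<in> coboundary ` C1 H A"
  then obtain \<theta> where x: "x = coboundary \<theta>" "\<theta> \<in> C1 H A" by blast
  note c [simp] = C1_center[OF x(2)]
  have "inv\<^bsub>cochain_group\<^esub> x = (\<lambda>x\<in>carrier H \<times> carrier H. inv fst (coboundary \<theta>) x,
      \<lambda>h\<in>carrier H. inv snd (coboundary \<theta>) h)"
    using inv_cochain_group[OF coboundary_closed[OF x(2)]] by (simp add: x)
  also have "\<dots> = coboundary (\<lambda>h\<in>carrier H. inv \<theta> h)"
    unfolding coboundary_def by (auto simp: central_simps intro!: restrict_ext)
  finally have "inv\<^bsub>cochain_group\<^esub> x = coboundary (\<lambda>h\<in>carrier H. inv \<theta> h)" .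
  moreover have "(\<lambda>h\<in>carrier H. inv \<theta> h) \<in> C1 H A" using x by (auto simp: C1_def)
  ultimately show "inv\<^bsub>cochain_group\<^esub> x \<in> coboundary ` C1 H A" by blast
qed

lemma comm_group_cocycle_group: "comm_group cocycle_group"
proof (rule group.group_comm_groupI)
  show "group cocycle_group"
    unfolding cocycle_group_eq
    by (rule subgroup.subgroup_is_group[OF subgroup_Z2_RBE group_cochain_group])
next
  fix x y assume "x \<in> carrier cocycle_group" "y \<in> carrier cocycle_group"
  then obtain f k f' k' where xy: "x = (f, k)" "y = (f', k')"
    and f: "f \<in> C2 H A" "f' \<in> C2 H A" and k: "k \<in> C1 H A" "k' \<in> C1 H A"
    by (cases x; cases y) (auto simp: Z2_RBE_def)
  show "x \<otimes>\<^bsub>cocycle_group\<^esub> y = y \<otimes>\<^bsub>cocycle_group\<^esub> x"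
    unfolding cocycle_group_eq
    using C2_center[OF f(1)] C2_center[OF f(2)] C1_center[OF k(1)] C1_center[OF k(2)]
    by (auto simp: xy I.center_ac(2) intro!: restrict_ext)
qed

lemma normal_coboundaries:
  "B2_RBE H RH A RI act \<inter> Z2_RBE H RH A RI act \<lhd> cocycle_group"
proof (rule comm_group.subgroup_imp_normal[OF comm_group_cocycle_group])
  interpret group cochain_group by (rule group_cochain_group)
  have "subgroup (B2_RBE H RH A RI act \<inter> Z2_RBE H RH A RI act) cochain_group"
    using subgroup_B2_RBE subgroup_Z2_RBE by (rule subgroups_Inter_pair)
  then show "subgroup (B2_RBE H RH A RI act \<inter> Z2_RBE H RH A RI act) cocycle_group"
    unfolding cocycle_group_eq by (rule subgroup_incl[OF _ subgroup_Z2_RBE]) simp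
qed

end

section \<open>The action of cocycles on triplets\<close>

context rota_baxter_groups
begin

text \<open>The parts \<open>p1\<close>, \<open>p2\<close> and \<open>w\<close> enter through
  equations so that they can be given in another form: for a shifted triplet, \<open>p1\<close> and
  \<open>p2\<close> are those of the original one, and \<open>w\<close> is the original with a
  central factor.\<close>

lemma triplet_rb_condition_iff:
  assumes "p1 = RI (inv g h1 \<otimes> \<mu> (RH h1) y1 \<otimes> g h1)"
    and "p2 = RI (inv g h2 \<otimes> \<mu> (RH h2) y2 \<otimes> g h2)"
    and "w = \<tau> (h1 \<otimes>\<^bsub>H\<^esub> RH h1, h2 \<otimes>\<^bsub>H\<^esub> inv\<^bsub>H\<^esub> RH h1)
      \<otimes> \<mu> (h2 \<otimes>\<^bsub>H\<^esub> inv\<^bsub>H\<^esub> RH h1) (\<tau> (h1, RH h1) \<otimes> \<mu> (RH h1) y1 \<otimes> g h1 \<otimes> p1)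
      \<otimes> \<tau> (h2, inv\<^bsub>H\<^esub> RH h1) \<otimes> \<mu> (inv\<^bsub>H\<^esub> RH h1) (y2 \<otimes> inv p1 \<otimes> inv g h1)
      \<otimes> inv \<tau> (RH h1, inv\<^bsub>H\<^esub> RH h1)"
  shows "triplet_rb_condition H RH I RI (\<mu>, \<tau>, g) h1 h2 y1 y2 \<longleftrightarrow>
    g (rb_circ H RH h1 h2) \<otimes> RI (inv g (rb_circ H RH h1 h2) \<otimes> \<mu> (RH h1 \<otimes>\<^bsub>H\<^esub> RH h2) w
        \<otimes> g (rb_circ H RH h1 h2))
    = \<tau> (RH h1, RH h2) \<otimes> \<mu> (RH h2) (g h1 \<otimes> p1) \<otimes> g h2 \<otimes> p2"
  unfolding assms by (simp add: triplet_rb_condition_def Let_def)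

text \<open>
  The second component enters inverted: with the signs of \<open>Z2_RBE\<close> and \<open>B2_RBE\<close> this is what
  makes the shift preserve the third triplet condition.
\<close>

definition shift ::
  "('h \<times> 'h \<Rightarrow> 'i) \<times> ('h \<Rightarrow> 'i) \<Rightarrow> ('h, 'i) triplet \<Rightarrow> ('h, 'i) triplet" where
  "shift = (\<lambda>(f, k) (\<mu>, \<tau>, g).
     (\<mu>, \<lambda>x\<in>carrier H \<times> carrier H. I.central_mult (\<tau> x) (f x),
      \<lambda>h\<in>carrier H. I.central_mult (g h) (inv k h)))"

end

lemma (in associated_triplet) mu_central_mult:
  "h \<in> carrier H \<Longrightarrow> x \<in> carrier I \<Longrightarrow> z \<in> center I \<Longrightarrow>
    \<mu> h (I.central_mult x z) = I.central_mult (\<mu> h x) (\<mu> h z)"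
  by (simp add: I.central_mult_def mu_mult I.center_closed)

text \<open>Here \<theta> may be non-central. Both sides of each gauge equation acquire the same
  central factor, \<open>f (h, l)\<close> or \<open>inv k h\<close>, while the arguments of
  \<open>RI\<close> are unaffected.\<close>

lemma (in rota_baxter_coupling) gauge_shift:
  assumes t: "(\<mu>, \<tau>, g) \<in> associated_triplets H RH I RI"
    and t': "(\<mu>', \<tau>', g') \<in> associated_triplets H RH I RI"
    and f: "f \<in> C2 H A" and k: "k \<in> C1 H A"
    and gauge: "gauge (\<mu>, \<tau>, g) (\<mu>', \<tau>', g') \<theta>"
  shows "gauge (shift (f, k) (\<mu>, \<tau>, g)) (shift (f, k) (\<mu>', \<tau>', g')) \<theta>"
proof -
  interpret T: associated_triplet H RH I RI \<mu> \<tau> g by unfold_locales (rule t)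
  interpret T': associated_triplet H RH I RI \<mu>' \<tau>' g' by unfold_locales (rule t')
  note c [simp] = C2_center[OF f] C1_center[OF k] gaugeD(1)[OF gauge]
  have "\<theta> (h \<otimes>\<^bsub>H\<^esub> l) \<otimes> (I.central_mult (\<tau> (h, l)) (f (h, l)) \<otimes> \<mu> l y)
      = I.central_mult (\<tau>' (h, l)) (f (h, l)) \<otimes> \<mu>' l (\<theta> h \<otimes> y) \<otimes> \<theta> l"
    if "h \<in> carrier H" "l \<in> carrier H" "y \<in> carrier I" for h l y
    using that gaugeD(2)[OF gauge that] by (simp add: I.central_mult_simps)
  moreover have "\<theta> (RH h) \<otimes> (I.central_mult (g h) (inv k h) \<otimes>
        RI (inv I.central_mult (g h) (inv k h) \<otimes> \<mu> (RH h) y \<otimes> I.central_mult (g h) (inv k h)))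
      = I.central_mult (g' h) (inv k h) \<otimes>
        RI (inv I.central_mult (g' h) (inv k h) \<otimes> \<mu>' (RH h) (\<theta> h \<otimes> y) \<otimes> I.central_mult (g' h) (inv k h))"
    if "h \<in> carrier H" "y \<in> carrier I" for h y
    using that gaugeD(3)[OF gauge that] by (simp add: I.conj_central_mult) (simp add: I.central_mult_simps)
  ultimately show ?thesis by (simp add: gauge_def shift_def)
qed

locale coupled_triplet = rota_baxter_coupling H RH I RI \<alpha>
  for H :: "('h, 'm) monoid_scheme" and RH
    and I :: "('i, 'n) monoid_scheme" (structure) and RI and \<alpha> +
  fixes \<mu> :: "'h \<Rightarrow> 'i \<Rightarrow> 'i" and \<tau> :: "'h \<times> 'h \<Rightarrow> 'i" and g :: "'h \<Rightarrow> 'i"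
  assumes coupled: "(\<mu>, \<tau>, g) \<in> coupled_triplets H RH I RI \<alpha>"
begin

sublocale associated_triplet H RH I RI \<mu> \<tau> g
  using coupled by unfold_locales (simp add: coupled_triplets_def)

lemma mu_eq_act: "h \<in> carrier H \<Longrightarrow> z \<in> center I \<Longrightarrow> \<mu> h z = act h z"
  using coupled I.coupling_action_eq[OF mu_auto, of h \<alpha> h z] by (simp add: coupled_triplets_def)

text \<open>The first triplet condition on the centre, where conjugation by
  \<open>\<tau> (h, l)\<close> is trivial.\<close>

lemma act_comp:
  assumes "h \<in> carrier H" "l \<in> carrier H" "z \<in> center I"
  shows "act (h \<otimes>\<^bsub>H\<^esub> l) z = act l (act h z)"
proof -
  have "act (h \<otimes>\<^bsub>H\<^esub> l) z = \<tau> (h, l) \<otimes> act l (act h z) \<otimes> inv \<tau> (h, l)"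
    using assms mu_comp[of h l z] by (simp add: mu_eq_act)
  also have "\<dots> = act l (act h z) \<otimes> \<tau> (h, l) \<otimes> inv \<tau> (h, l)"
    using assms by (simp add: I.center_commute)
  finally show ?thesis using assms by (simp add: I.m_assoc)
qed

lemma mu_central_mult_act:
  "h \<in> carrier H \<Longrightarrow> x \<in> carrier I \<Longrightarrow> z \<in> center I \<Longrightarrow>
    \<mu> h (I.central_mult x z) = I.central_mult (\<mu> h x) (act h z)"
  by (simp add: mu_central_mult mu_eq_act)

text \<open>The first condition is insensitive to central factors of \<tau>; the second and third
  reduce to the two equations of \<open>cocycle_eqs\<close>.\<close>

lemma shift_coupled:
  assumes "c \<in> Z2_RBE H RH A RI act"
  shows "shift c (\<mu>, \<tau>, g) \<in> coupled_triplets H RH I RI \<alpha>"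
proof -
  obtain f k where c: "c = (f, k)" by (cases c)
  have f: "f \<in> C2 H A" and k: "k \<in> C1 H A" and e: "cocycle_eqs f k"
    using assms by (simp_all add: c Z2_RBE_iff)
  note cl [simp] = C2_center[OF f] C1_center[OF k]
  define \<tau>' where "\<tau>' = (\<lambda>x\<in>carrier H \<times> carrier H. I.central_mult (\<tau> x) (f x))"
  define g' where "g' = (\<lambda>h\<in>carrier H. I.central_mult (g h) (inv k h))"
  have t': "\<tau>' (h, l) = I.central_mult (\<tau> (h, l)) (f (h, l))" if "h \<in> carrier H" "l \<in> carrier H" for h l
    using that by (simp add: \<tau>'_def)
  have g': "g' h = I.central_mult (g h) (inv k h)" if "h \<in> carrier H" for h
    using that by (simp add: g'_def)
  note S = I.central_mult_simps mu_central_mult_act RI_central_mult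
  have conj: "inv g' h \<otimes> y \<otimes> g' h = inv g h \<otimes> y \<otimes> g h" if "h \<in> carrier H" "y \<in> carrier I" for h y
    using that by (simp add: g' I.conj_central_mult)
  have norm: "\<tau>' (\<one>\<^bsub>H\<^esub>, h) = \<one>" "\<tau>' (h, \<one>\<^bsub>H\<^esub>) = \<one>" if "h \<in> carrier H" for h
    using that f by (simp_all add: t' C2_def I.central_mult_one)
  have norm': "g' \<one>\<^bsub>H\<^esub> = \<one>" using k by (simp add: g' C1_def I.central_mult_one)
  have T1: "\<mu> (h \<otimes>\<^bsub>H\<^esub> l) y = inner_auto I (\<tau>' (h, l)) (\<mu> l (\<mu> h y))"
    if "h \<in> carrier H" "l \<in> carrier H" "y \<in> carrier I" for h l y
    using that by (simp add: mu_comp inner_auto_def t' S I.central_mult_one)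
  have T2: "\<tau>' (h1, h2 \<otimes>\<^bsub>H\<^esub> h3) \<otimes> \<tau>' (h2, h3) = \<tau>' (h1 \<otimes>\<^bsub>H\<^esub> h2, h3) \<otimes> \<mu> h3 (\<tau>' (h1, h2))"
    if "h1 \<in> carrier H" "h2 \<in> carrier H" "h3 \<in> carrier H" for h1 h2 h3
    using that cocycle_eqsD(1)[OF e that] tau_cocycle[OF that] by (simp add: t' S I.center_ac)
  have T3: "triplet_rb_condition H RH I RI (\<mu>, \<tau>', g') h l y z"
    if [simp]: "h \<in> carrier H" "l \<in> carrier H" "y \<in> carrier I" "z \<in> carrier I" for h l y z
  proof -
    let ?m = "rb_circ H RH h l" and ?s = "inv\<^bsub>H\<^esub> RH h"
    define p1 where "p1 = RI (inv g h \<otimes> \<mu> (RH h) y \<otimes> g h)"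
    define p2 where "p2 = RI (inv g l \<otimes> \<mu> (RH l) z \<otimes> g l)"
    have [simp]: "p1 \<in> carrier I" "p2 \<in> carrier I" by (simp_all add: p1_def p2_def)
    define w where "w = \<tau> (h \<otimes>\<^bsub>H\<^esub> RH h, l \<otimes>\<^bsub>H\<^esub> ?s) \<otimes> \<mu> (l \<otimes>\<^bsub>H\<^esub> ?s) (\<tau> (h, RH h) \<otimes> \<mu> (RH h) y \<otimes> g h \<otimes> p1)
      \<otimes> \<tau> (l, ?s) \<otimes> \<mu> ?s (z \<otimes> inv p1 \<otimes> inv g h) \<otimes> inv \<tau> (RH h, ?s)"
    have [simp]: "w \<in> carrier I" by (simp add: w_def)
    \<comment> \<open>The contribution of \<open>k\<close> to \<open>w\<close>: there
      \<open>g h\<close> occurs under \<open>\<mu> (l \<otimes> ?s)\<close> and its inverse under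
      \<open>\<mu> ?s\<close>, and the shift multiplies \<open>g h\<close> by
      \<open>inv k h\<close>.\<close>
    define d where "d = act (l \<otimes>\<^bsub>H\<^esub> ?s) (inv k h) \<otimes> act ?s (k h)"
    have [simp]: "d \<in> center I" by (simp add: d_def)
    define D where "D = RI (act (RH h \<otimes>\<^bsub>H\<^esub> RH l) (cochain_defect f h l))"
    have [simp]: "D \<in> center I" using f by (simp add: D_def)
    define Y where "Y = RI (act (RH l) (act l (k h) \<otimes> inv k h))"
    have [simp]: "Y \<in> center I" by (simp add: Y_def)
    have w': "I.central_mult w (cochain_defect f h l \<otimes> d)
      = \<tau>' (h \<otimes>\<^bsub>H\<^esub> RH h, l \<otimes>\<^bsub>H\<^esub> ?s) \<otimes> \<mu> (l \<otimes>\<^bsub>H\<^esub> ?s) (\<tau>' (h, RH h) \<otimes> \<mu> (RH h) y \<otimes> g' h \<otimes> p1)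
        \<otimes> \<tau>' (l, ?s) \<otimes> \<mu> ?s (z \<otimes> inv p1 \<otimes> inv g' h) \<otimes> inv \<tau>' (RH h, ?s)"
      by (simp add: w_def t' g' S d_def cochain_defect_def central_simps)
    \<comment> \<open>As \<open>act\<close> reverses products, applying the action of
      \<open>RH h \<otimes> RH l\<close> last cancels \<open>?s\<close> against \<open>RH h\<close>.
      So \<open>d\<close> contributes exactly the term \<open>Y\<close> of the cocycle equation,
      inverted.\<close>
    have "act (RH h \<otimes>\<^bsub>H\<^esub> RH l) (act (l \<otimes>\<^bsub>H\<^esub> ?s) x) = act (RH l) (act l x)"
        "act (RH h \<otimes>\<^bsub>H\<^esub> RH l) (act ?s x) = act (RH l) x" if "x \<in> center I" for x
      using that by (simp_all add: act_comp[symmetric] H.m_assoc[symmetric])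
        (simp_all add: H.m_assoc)
    then have d': "RI (act (RH h \<otimes>\<^bsub>H\<^esub> RH l) d) = inv Y"
      by (simp add: d_def Y_def central_simps)
    have L: "g' ?m \<otimes> RI (inv g' ?m \<otimes> \<mu> (RH h \<otimes>\<^bsub>H\<^esub> RH l) (I.central_mult w (cochain_defect f h l \<otimes> d)) \<otimes> g' ?m)
      = I.central_mult (g ?m \<otimes> RI (inv g ?m \<otimes> \<mu> (RH h \<otimes>\<^bsub>H\<^esub> RH l) w \<otimes> g ?m)) (inv k ?m \<otimes> (D \<otimes> inv Y))"
      using f by (simp add: conj S) (simp add: g' S central_simps D_def d')
    have R: "\<tau>' (RH h, RH l) \<otimes> \<mu> (RH l) (g' h \<otimes> p1) \<otimes> g' l \<otimes> p2
      = I.central_mult (\<tau> (RH h, RH l) \<otimes> \<mu> (RH l) (g h \<otimes> p1) \<otimes> g l \<otimes> p2)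
          (f (RH h, RH l) \<otimes> (inv act (RH l) (k h) \<otimes> inv k l))"
      by (simp add: t' g' S central_simps)
    \<comment> \<open>The cocycle equation as a quotient equal to \<open>\<one>\<close>. Up to order
      this is also the quotient of the central factors in \<open>L\<close> and
      \<open>R\<close>.\<close>
    have "k l \<otimes> act (RH l) (k h) \<otimes> D \<otimes> inv (f (RH h, RH l) \<otimes> k ?m \<otimes> Y) = \<one>"
      using cocycle_eqsD(2)[OF e, of h l] by (simp add: D_def Y_def)
    then have "inv k ?m \<otimes> (D \<otimes> inv Y) = f (RH h, RH l) \<otimes> (inv act (RH l) (k h) \<otimes> inv k l)"
      by (subst center_eq_one_iff[symmetric]) (simp_all add: central_simps)
    moreover have "triplet_rb_condition H RH I RI (\<mu>, \<tau>, g) h l y z"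
      by (rule rb_condition) simp_all
    then have "g ?m \<otimes> RI (inv g ?m \<otimes> \<mu> (RH h \<otimes>\<^bsub>H\<^esub> RH l) w \<otimes> g ?m)
      = \<tau> (RH h, RH l) \<otimes> \<mu> (RH l) (g h \<otimes> p1) \<otimes> g l \<otimes> p2"
      by (subst (asm) triplet_rb_condition_iff[OF p1_def p2_def w_def])
    moreover have "p1 = RI (inv g' h \<otimes> \<mu> (RH h) y \<otimes> g' h)" "p2 = RI (inv g' l \<otimes> \<mu> (RH l) z \<otimes> g' l)"
      by (simp_all add: conj p1_def p2_def)
    note triplet_rb_condition_iff[where \<mu> = \<mu> and \<tau> = \<tau>' and g = g' and ?h1.0 = h and ?h2.0 = l
        and ?y1.0 = y and ?y2.0 = z, OF this w']
    ultimately show ?thesis by (simp only: L R)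
  qed
  have "\<tau>' \<in> carrier H \<times> carrier H \<rightarrow>\<^sub>E carrier I" "g' \<in> carrier H \<rightarrow>\<^sub>E carrier I"
    by (auto simp: \<tau>'_def g'_def I.central_mult_closed)
  then have "(\<mu>, \<tau>', g') \<in> associated_triplets H RH I RI"
    using associated norm norm' T1 T2 T3 by (simp add: associated_triplets_def)
  moreover have "shift c (\<mu>, \<tau>, g) = (\<mu>, \<tau>', g')" by (simp add: shift_def c \<tau>'_def g'_def)
  ultimately show ?thesis using coupled by (simp add: coupled_triplets_def)
qed

end

section \<open>Stabilizers of classes and the laws of the action\<close>

context coupled_triplet
begin

lemma shift_gauge_iff:
  assumes "c \<in> Z2_RBE H RH A RI act"
  shows "(\<exists>\<theta>. gauge (shift c (\<mu>, \<tau>, g)) (\<mu>, \<tau>, g) \<theta>) \<longleftrightarrow> c \<in> B2_RBE H RH A RI act"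
proof -
  obtain f k where c: "c = (f, k)" by (cases c)
  have f: "f \<in> C2 H A" and k: "k \<in> C1 H A"
    using assms by (simp_all add: c Z2_RBE_iff)
  note cl [simp] = C2_center[OF f] C1_center[OF k]
  \<comment> \<open>For central \<theta> the element \<open>y\<close> drops out of the gauge
    equations, as all factors coming from \<theta>, \<open>f\<close> and \<open>k\<close> can be
    collected on the right. Both directions of the lemma use this equivalence.\<close>
  have gauge_central_iff: "gauge (shift c (\<mu>, \<tau>, g)) (\<mu>, \<tau>, g) \<theta> \<longleftrightarrow>
      (\<forall>h\<in>carrier H. \<forall>l\<in>carrier H. f (h, l) = \<theta> l \<otimes> inv \<theta> (h \<otimes>\<^bsub>H\<^esub> l) \<otimes> act l (\<theta> h)) \<and>
      (\<forall>h\<in>carrier H. k h = \<theta> (RH h) \<otimes> inv RI (act (RH h) (\<theta> h)))"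
    if th [simp]: "\<And>h. h \<in> carrier H \<Longrightarrow> \<theta> h \<in> center I" for \<theta>
  proof -
    have flip: "\<theta> h \<otimes> y = I.central_mult y (\<theta> h)" "y \<otimes> \<theta> h = I.central_mult y (\<theta> h)" if "h \<in> carrier H" "y \<in> carrier I" for h y
      using that by (simp_all add: I.central_mult_def I.center_commute)
    have cancel: "I.central_mult x a = I.central_mult x b \<longleftrightarrow> a = b"
      if "x \<in> carrier I" "a \<in> center I" "b \<in> center I" for x a b
      using that by (simp add: I.central_mult_def)
    have "\<theta> (h \<otimes>\<^bsub>H\<^esub> l) \<otimes> (I.central_mult (\<tau> (h, l)) (f (h, l)) \<otimes> \<mu> l y)
          = \<tau> (h, l) \<otimes> \<mu> l (\<theta> h \<otimes> y) \<otimes> \<theta> l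
        \<longleftrightarrow> f (h, l) = \<theta> l \<otimes> inv \<theta> (h \<otimes>\<^bsub>H\<^esub> l) \<otimes> act l (\<theta> h)"
      if [simp]: "h \<in> carrier H" "l \<in> carrier H" "y \<in> carrier I" for h l y
    proof -
      have "\<theta> (h \<otimes>\<^bsub>H\<^esub> l) \<otimes> (I.central_mult (\<tau> (h, l)) (f (h, l)) \<otimes> \<mu> l y)
          = I.central_mult (\<tau> (h, l) \<otimes> \<mu> l y) (f (h, l) \<otimes> \<theta> (h \<otimes>\<^bsub>H\<^esub> l))"
        by (simp add: flip I.central_mult_simps)
      moreover have "\<tau> (h, l) \<otimes> \<mu> l (\<theta> h \<otimes> y) \<otimes> \<theta> l
          = I.central_mult (\<tau> (h, l) \<otimes> \<mu> l y) (act l (\<theta> h) \<otimes> \<theta> l)"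
        by (simp add: flip I.central_mult_simps mu_central_mult_act)
      ultimately have "\<theta> (h \<otimes>\<^bsub>H\<^esub> l) \<otimes> (I.central_mult (\<tau> (h, l)) (f (h, l)) \<otimes> \<mu> l y)
          = \<tau> (h, l) \<otimes> \<mu> l (\<theta> h \<otimes> y) \<otimes> \<theta> l
        \<longleftrightarrow> f (h, l) \<otimes> \<theta> (h \<otimes>\<^bsub>H\<^esub> l) = act l (\<theta> h) \<otimes> \<theta> l"
        by (simp only: cancel) (simp add: cancel)
      also have "\<dots> \<longleftrightarrow> f (h, l) = \<theta> l \<otimes> inv \<theta> (h \<otimes>\<^bsub>H\<^esub> l) \<otimes> act l (\<theta> h)"
        by (subst (1 2) center_eq_one_iff[symmetric]) (simp_all add: central_simps)
      finally show ?thesis .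
    qed
    moreover have "\<theta> (RH h) \<otimes> (I.central_mult (g h) (inv k h) \<otimes>
          RI (inv I.central_mult (g h) (inv k h) \<otimes> \<mu> (RH h) y \<otimes> I.central_mult (g h) (inv k h)))
          = g h \<otimes> RI (inv g h \<otimes> \<mu> (RH h) (\<theta> h \<otimes> y) \<otimes> g h)
        \<longleftrightarrow> k h = \<theta> (RH h) \<otimes> inv RI (act (RH h) (\<theta> h))"
      if [simp]: "h \<in> carrier H" "y \<in> carrier I" for h y
    proof -
      let ?q = "g h \<otimes> RI (inv g h \<otimes> \<mu> (RH h) y \<otimes> g h)"
      have "\<theta> (RH h) \<otimes> (I.central_mult (g h) (inv k h) \<otimes>
          RI (inv I.central_mult (g h) (inv k h) \<otimes> \<mu> (RH h) y \<otimes> I.central_mult (g h) (inv k h)))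
          = I.central_mult ?q (inv k h \<otimes> \<theta> (RH h))"
        by (simp add: I.conj_central_mult) (simp add: flip I.central_mult_simps)
      moreover have "g h \<otimes> RI (inv g h \<otimes> \<mu> (RH h) (\<theta> h \<otimes> y) \<otimes> g h)
          = I.central_mult ?q (RI (act (RH h) (\<theta> h)))"
        by (simp add: flip I.central_mult_simps mu_central_mult_act RI_central_mult)
      \<comment> \<open>The shift inserts \<open>inv k h\<close>, so the quotient that arises is the
        inverse of the one for \<open>k h\<close>.\<close>
      moreover have "inv k h \<otimes> \<theta> (RH h) = RI (act (RH h) (\<theta> h))
          \<longleftrightarrow> inv (k h \<otimes> inv (\<theta> (RH h) \<otimes> inv RI (act (RH h) (\<theta> h)))) = \<one>"
        by (subst center_eq_one_iff[symmetric]) (simp_all add: central_simps)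
      moreover have "\<dots> \<longleftrightarrow> k h \<otimes> inv (\<theta> (RH h) \<otimes> inv RI (act (RH h) (\<theta> h))) = \<one>"
        by (intro I.inv_eq_1_iff) simp
      moreover have "\<dots> \<longleftrightarrow> k h = \<theta> (RH h) \<otimes> inv RI (act (RH h) (\<theta> h))"
        by (rule center_eq_one_iff) simp_all
      ultimately show ?thesis by (simp add: cancel)
    qed
    ultimately show ?thesis
      unfolding gauge_def shift_def c prod.case
      by (auto simp: Pi_iff)
  qed
  show ?thesis
  proof
    assume "\<exists>\<theta>. gauge (shift c (\<mu>, \<tau>, g)) (\<mu>, \<tau>, g) \<theta>"
    then obtain \<theta> where gauge: "gauge (shift c (\<mu>, \<tau>, g)) (\<mu>, \<tau>, g) \<theta>" ..
    note D = gaugeD[OF gauge[unfolded shift_def c prod.case]]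
    have th [simp]: "\<theta> h \<in> carrier I" if "h \<in> carrier H" for h using D(1) that .
    have f_one: "f (\<one>\<^bsub>H\<^esub>, h) = \<one>" if "h \<in> carrier H" for h
      using f that by (simp add: C2_def)
    have one: "\<theta> \<one>\<^bsub>H\<^esub> = \<one>"
      using D(2)[of "\<one>\<^bsub>H\<^esub>" "\<one>\<^bsub>H\<^esub>" \<one>] by (simp add: f_one I.central_mult_one)
    have central: "\<theta> h \<in> center I" if h: "h \<in> carrier H" for h
    proof (rule I.centerI)
      fix x assume "x \<in> carrier I"
      then have "x \<in> \<mu> h ` carrier I" by (simp only: mu_surj[OF h])
      then obtain y where y: "x = \<mu> h y" "y \<in> carrier I" by (rule imageE)
      \<comment> \<open>With first argument \<open>\<one>\<close> the factors from \<tau>,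
        \<open>f\<close> and \<open>\<theta> \<one>\<close> are trivial, and the gauge equation says
        that \<open>\<theta> h\<close> commutes with \<open>\<mu> h y\<close>.\<close>
      show "\<theta> h \<otimes> x = x \<otimes> \<theta> h"
        using D(2)[of "\<one>\<^bsub>H\<^esub>" h y] h y by (simp add: f_one I.central_mult_one one)
    qed (use h in simp)
    \<comment> \<open>\<open>gauge\<close> leaves the values outside \<open>carrier H\<close> open,
      while members of \<open>C1\<close> are extensional.\<close>
    define \<theta>' where "\<theta>' = restrict \<theta> (carrier H)"
    have C1: "\<theta>' \<in> C1 H A" using central one by (auto simp: \<theta>'_def C1_def)
    moreover have "c = coboundary \<theta>'"
    proof -
      have fe: "\<And>h l. h \<in> carrier H \<Longrightarrow> l \<in> carrier H \<Longrightarrow>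
          f (h, l) = \<theta> l \<otimes> inv \<theta> (h \<otimes>\<^bsub>H\<^esub> l) \<otimes> act l (\<theta> h)"
        and ke: "\<And>h. h \<in> carrier H \<Longrightarrow> k h = \<theta> (RH h) \<otimes> inv RI (act (RH h) (\<theta> h))"
        using iffD1[OF gauge_central_iff[of \<theta>, OF central] gauge] by simp_all
      have fP: "f \<in> carrier H \<times> carrier H \<rightarrow>\<^sub>E center I" and kP: "k \<in> carrier H \<rightarrow>\<^sub>E center I"
        using f k by (simp_all add: C1_def C2_def)
      have "f = fst (coboundary \<theta>')"
        by (rule PiE_ext[OF fP coboundary_closed(1)[OF C1]]) (auto simp: coboundary_def \<theta>'_def fe)
      moreover have "k = snd (coboundary \<theta>')"
        by (rule PiE_ext[OF kP coboundary_closed(2)[OF C1]]) (simp add: coboundary_def \<theta>'_def ke)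
      ultimately show ?thesis by (simp add: c)
    qed
    ultimately show "c \<in> B2_RBE H RH A RI act" by (simp add: B2_RBE_eq)
  next
    assume "c \<in> B2_RBE H RH A RI act"
    then obtain \<theta> where "c = coboundary \<theta>" "\<theta> \<in> C1 H A" by (auto simp: B2_RBE_eq)
    then have "gauge (shift c (\<mu>, \<tau>, g)) (\<mu>, \<tau>, g) \<theta>"
      by (intro iffD2[OF gauge_central_iff]) (auto simp: C1_center c coboundary_def)
    then show "\<exists>\<theta>. gauge (shift c (\<mu>, \<tau>, g)) (\<mu>, \<tau>, g) \<theta>" by blast
  qed
qed

text \<open>On the right the factors of \<open>d\<close> are attached before those of
  \<open>c\<close>, so the equality rests on the commutativity of the centre.\<close>

lemma shift_mult:
  assumes "c \<in> Z2_RBE H RH A RI act" "d \<in> Z2_RBE H RH A RI act"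
  shows "shift (c \<otimes>\<^bsub>cocycle_group\<^esub> d) (\<mu>, \<tau>, g) = shift c (shift d (\<mu>, \<tau>, g))"
proof -
  obtain f k f' k' where cd: "c = (f, k)" "d = (f', k')" by (cases c; cases d)
  have f: "f \<in> C2 H A" "f' \<in> C2 H A" and k: "k \<in> C1 H A" "k' \<in> C1 H A"
    using assms by (simp_all add: cd Z2_RBE_iff)
  note cl [simp] = C2_center[OF f(1)] C2_center[OF f(2)] C1_center[OF k(1)] C1_center[OF k(2)]
  show ?thesis
    unfolding cocycle_group_eq
    by (auto simp: cd shift_def I.central_mult_simps I.center_inv_mult I.center_ac(2) intro!: restrict_ext)
qed

text \<open>Shifted components are restricted to the carrier, so the original triplet returns
  because its own components are extensional.\<close>

lemma shift_one: "shift \<one>\<^bsub>cocycle_group\<^esub> (\<mu>, \<tau>, g) = (\<mu>, \<tau>, g)"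
proof -
  have "\<tau> \<in> extensional (carrier H \<times> carrier H)" "g \<in> extensional (carrier H)"
    using associated by (simp_all add: associated_triplets_def PiE_iff)
  then show ?thesis
    unfolding cocycle_group_eq
    by (auto simp: shift_def I.central_mult_one intro!: extensionalityI[of _ "carrier H"]
        extensionalityI[of _ "carrier H \<times> carrier H"])
qed

end

section \<open>The free action on classes of triplets\<close>

theorem theorem5p11:
  fixes H :: "'h monoid" and RH :: "'h \<Rightarrow> 'h"
    and I :: "'i monoid" and RI :: "'i \<Rightarrow> 'i"
    and \<alpha> :: "'h \<Rightarrow> ('i \<Rightarrow> 'i) set"
  assumes "rota_baxter_group H RH" and "rota_baxter_group I RI"
    and "RI ` center I \<subseteq> center I"
    and "coupling H I \<alpha>"
  shows "\<exists>\<phi>. group_action (H2_RBE H RH (center_group I) RI (coupling_action \<alpha>))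
               (triplet_classes H RH I RI \<alpha>) \<phi> \<and>
             (\<forall>x \<in> triplet_classes H RH I RI \<alpha>.
                stabilizer (H2_RBE H RH (center_group I) RI (coupling_action \<alpha>)) \<phi> x
                = {\<one>\<^bsub>H2_RBE H RH (center_group I) RI (coupling_action \<alpha>)\<^esub>})"
proof -
  interpret rota_baxter_coupling H RH I RI \<alpha> by unfold_locales (rule assms)+
  have triplet: "coupled_triplet H RH I RI \<alpha> (fst t) (fst (snd t)) (snd (snd t))"
    if "t \<in> coupled_triplets H RH I RI \<alpha>" for t
    using that by unfold_locales simp
  have assoc: "t \<in> associated_triplets H RH I RI" if "t \<in> coupled_triplets H RH I RI \<alpha>" for t
    using that by (auto simp: coupled_triplets_def)
  have closed: "shift c t \<in> coupled_triplets H RH I RI \<alpha>"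
    if "c \<in> carrier cocycle_group" "t \<in> coupled_triplets H RH I RI \<alpha>" for c t
    using coupled_triplet.shift_coupled[OF triplet[OF that(2)]] that(1) by simp
  have gauge_iff: "triplet_equiv H RH I RI s t \<longleftrightarrow> (\<exists>\<theta>. gauge s t \<theta>)"
    if "s \<in> coupled_triplets H RH I RI \<alpha>" "t \<in> coupled_triplets H RH I RI \<alpha>" for s t
    using triplet_equiv_iff_gauge[of "fst s" "fst (snd s)" "snd (snd s)" "fst t" "fst (snd t)" "snd (snd t)"]
      that[THEN assoc] by simp
  have cong: "triplet_equiv H RH I RI (shift c s) (shift c t)"
    if c: "c \<in> carrier cocycle_group" and st: "s \<in> coupled_triplets H RH I RI \<alpha>"
      "t \<in> coupled_triplets H RH I RI \<alpha>" and eq: "triplet_equiv H RH I RI s t" for c s t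
  proof -
    obtain \<theta> where "gauge s t \<theta>" using eq gauge_iff[OF st] by blast
    moreover have "fst c \<in> C2 H A" "snd c \<in> C1 H A" using c by (auto simp: Z2_RBE_def)
    ultimately have "gauge (shift c s) (shift c t) \<theta>"
      using gauge_shift[of "fst s" "fst (snd s)" "snd (snd s)" "fst t" "fst (snd t)" "snd (snd t)"
          "fst c" "snd c" \<theta>] st[THEN assoc] by simp
    then show ?thesis using gauge_iff[OF closed[OF c st(1)] closed[OF c st(2)]] by blast
  qed
  \<comment> \<open>Elements of \<open>cocycle_group\<close> lie in \<open>Z2_RBE\<close>, so for
    them membership in the intersection is membership in \<open>B2_RBE\<close>.\<close>
  have free: "triplet_equiv H RH I RI (shift c t) t \<longleftrightarrow> c \<in> B2_RBE H RH A RI act"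
    if "c \<in> carrier cocycle_group" "t \<in> coupled_triplets H RH I RI \<alpha>" for c t
    using coupled_triplet.shift_gauge_iff[OF triplet[OF that(2)]] gauge_iff[OF closed[OF that] that(2)]
      that(1) by simp
  show ?thesis
    unfolding H2_RBE_def triplet_classes_def
  proof (rule free_action_on_quotient[where act = shift, OF normal_coboundaries equiv_triplet_equiv])
    show "shift (c \<otimes>\<^bsub>cocycle_group\<^esub> d) t = shift c (shift d t)"
      if "c \<in> carrier cocycle_group" "d \<in> carrier cocycle_group"
        "t \<in> coupled_triplets H RH I RI \<alpha>" for c d t
      using coupled_triplet.shift_mult[OF triplet[OF that(3)]] that(1,2) by simp
    show "shift \<one>\<^bsub>cocycle_group\<^esub> t = t" if "t \<in> coupled_triplets H RH I RI \<alpha>" for t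
      using coupled_triplet.shift_one[OF triplet[OF that]] by simp
  qed (use closed cong free in auto)
qed

end
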